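(* Let $a\le b$ be positive integers; in each item below assume that the part sizes $p\le q$ of the forbidden tree satisfy $p\le a$ and $q\le b$. \begin{enumerate} \item Let $s,t\ge 1$ be integers with $s\le t<2s$ and $a,b\ge 4(s+1)^3$. Then $\mathrm{ex}_b(a,b,D_{s,t})=s(a+b-2s)$. Moreover, the unique extremal graph (up to isomorphism) is $K_{s,a-s}\cup K_{s,b-s}$. \item Let $s,t\ge 1$ be integers with $s\le t<2s$, $D_{s,t}\not\cong P_4$ (i.e. $s\ge 2$) and $a,b\ge 4(s+1)^3$. Then $\mathrm{ex}_{b,c}(a,b,D_{s,t})=s(a+b-2s)-1$. \item Let $s,t\ge 1$ be integers with $2s\le t$. Then $\mathrm{ex}_b(a,b,D_{s,t})\le t(a+b)/2$, and equality holds if $a=b=n$ is divisible by $t$. \item Let $\ell\ge 2$ be an integer. Then $\mathrm{ex}_b(a,b,S_{2\ell,(\ell+1)*1})\le \ell(a+b)$, and equality holds if $a=b=n$ is divisible by $2\ell$. \item Let $r,t\ge 1$ and $s\ge 0$ be integers with $s<m:=\max\{r,t\}$. Then $\mathrm{ex}_b(a,b,P_{r,s,t})\le m(a+b)$. \end{enumerate}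
   Context: All graphs are finite and simple. A graph is $F$-free if it has no (not necessarily induced) subgraph isomorphic to $F$. $\mathrm{ex}_b(a,b,F)$ (resp. $\mathrm{ex}_{b,c}(a,b,F)$) is the largest number of edges of an $F$-free bipartite graph (resp. $F$-free connected bipartite graph) with parts of sizes $a$ and $b$; an extremal graph is one attaining the maximum. The double star $D_{s,t}$ is the tree on $s+t+2$ vertices consisting of an edge $uv$ with $s$ leaves attached to $u$ and $t$ leaves attached to $v$. $S_{2\ell,(\ell+1)*1}$ is the tree obtained from one path with $2\ell$ edges and $\ell+1$ paths with one edge by identifying one endpoint of all these paths. $P_{r,s,t}$ is the tree on $r+s+t+3$ vertices consisting of a path $uvw$ with $r$ leaves attached to $u$, $s$ leaves attached to $v$, and $t$ leaves attached to $w$. $P_4$ is the path on 4 vertices. $G\cup H$ is the vertex-disjoint union; in $K_{s,a-s}\cup K_{s,b-s}$, viewed as a subgraph of $K_{a,b}$ with parts $A,B$ of sizes $a,b$, the first component has $a-s$ vertices in $A$ and $s$ in $B$, and the second has $s$ vertices in $A$ and $b-s$ in $B$. *)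

theory Defs
  imports Complex_Main
begin

type_synonym 'v graph = "'v set \<times> 'v set set"

abbreviation verts :: "'v graph \<Rightarrow> 'v set" where "verts G \<equiv> fst G"
abbreviation edges :: "'v graph \<Rightarrow> 'v set set" where "edges G \<equiv> snd G"

definition simple_graph :: "'v graph \<Rightarrow> bool" where
  "simple_graph G \<longleftrightarrow> finite (verts G) \<and> (\<forall>e\<in>edges G. e \<subseteq> verts G \<and> card e = 2)"

definition subgraph :: "'v graph \<Rightarrow> 'v graph \<Rightarrow> bool" where
  "subgraph H G \<longleftrightarrow> simple_graph H \<and> verts H \<subseteq> verts G \<and> edges H \<subseteq> edges G"

definition isomorphic :: "'v graph \<Rightarrow> 'w graph \<Rightarrow> bool" where
  "isomorphic G H \<longleftrightarrow>
     (\<exists>f. bij_betw f (verts G) (verts H) \<and> edges H = (\<lambda>e. f ` e) ` edges G)"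

definition free_of :: "'w graph \<Rightarrow> 'v graph \<Rightarrow> bool" where
  "free_of F G \<longleftrightarrow> \<not> (\<exists>H. subgraph H G \<and> isomorphic F H)"

definition connected_graph :: "'v graph \<Rightarrow> bool" where
  "connected_graph G \<longleftrightarrow> verts G \<noteq> {} \<and>
     (\<forall>x\<in>verts G. \<forall>y\<in>verts G. (x, y) \<in> {(u, v). {u, v} \<in> edges G}\<^sup>*)"

definition bipartition :: "'v graph \<Rightarrow> 'v set \<Rightarrow> 'v set \<Rightarrow> bool" where
  "bipartition G A B \<longleftrightarrow> A \<union> B = verts G \<and> A \<inter> B = {} \<and>
     (\<forall>e\<in>edges G. \<exists>x\<in>A. \<exists>y\<in>B. e = {x, y})"

definition bipartite_graph :: "nat \<Rightarrow> nat \<Rightarrow> 'v graph \<Rightarrow> bool" where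
  "bipartite_graph a b G \<longleftrightarrow> simple_graph G \<and>
     (\<exists>A B. bipartition G A B \<and> card A = a \<and> card B = b)"

text \<open>Every finite graph has an isomorphic copy with vertices in \<open>nat\<close>, so the maxima
  below range over such graphs.\<close>

definition ex_b :: "nat \<Rightarrow> nat \<Rightarrow> 'w graph \<Rightarrow> nat" where
  "ex_b a b F = Max {card (edges G) | G :: nat graph. bipartite_graph a b G \<and> free_of F G}"

definition ex_bc :: "nat \<Rightarrow> nat \<Rightarrow> 'w graph \<Rightarrow> nat" where
  "ex_bc a b F = Max {card (edges G) | G :: nat graph.
     bipartite_graph a b G \<and> connected_graph G \<and> free_of F G}"

definition extremal_b :: "nat \<Rightarrow> nat \<Rightarrow> 'w graph \<Rightarrow> 'v graph \<Rightarrow> bool" where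
  "extremal_b a b F G \<longleftrightarrow>
     bipartite_graph a b G \<and> free_of F G \<and> card (edges G) = ex_b a b F"

definition path_graph :: "nat \<Rightarrow> nat graph" where
  "path_graph n = ({..<n}, {{i, Suc i} | i. Suc i < n})"

text \<open>In the next two trees, \<open>(i, 0)\<close> is the \<open>i\<close>-th vertex of the central path, and
  \<open>(i, j)\<close> with \<open>j \<ge> 1\<close> is the \<open>j\<close>-th leaf attached to it.\<close>

definition double_star :: "nat \<Rightarrow> nat \<Rightarrow> (nat \<times> nat) graph" where
  "double_star s t =
     ({0} \<times> {0..s} \<union> {1} \<times> {0..t},
      {{(0, 0), (1, 0)}} \<union> {{(0, 0), (0, j)} | j. j \<in> {1..s}}
        \<union> {{(1, 0), (1, j)} | j. j \<in> {1..t}})"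

definition P_tree :: "nat \<Rightarrow> nat \<Rightarrow> nat \<Rightarrow> (nat \<times> nat) graph" where
  "P_tree r s t =
     ({0} \<times> {0..r} \<union> {1} \<times> {0..s} \<union> {2} \<times> {0..t},
      {{(0, 0), (1, 0)}, {(1, 0), (2, 0)}} \<union> {{(0, 0), (0, j)} | j. j \<in> {1..r}}
        \<union> {{(1, 0), (1, j)} | j. j \<in> {1..s}} \<union> {{(2, 0), (2, j)} | j. j \<in> {1..t}})"

text \<open>\<open>leg_vertex i j\<close> is the vertex at distance \<open>j\<close> from the start of the \<open>i\<close>-th path;
  the starting vertices of all paths are identified to the single vertex \<open>None\<close>.\<close>

definition leg_vertex :: "nat \<Rightarrow> nat \<Rightarrow> (nat \<times> nat) option" where
  "leg_vertex i j = (if j = 0 then None else Some (i, j))"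

text \<open>The list gives the numbers of edges of the paths.\<close>

definition spider :: "nat list \<Rightarrow> (nat \<times> nat) option graph" where
  "spider ks =
     ({None} \<union> {leg_vertex i j | i j. i < length ks \<and> j \<le> ks ! i},
      {{leg_vertex i j, leg_vertex i (Suc j)} | i j. i < length ks \<and> j < ks ! i})"

definition S_tree :: "nat \<Rightarrow> (nat \<times> nat) option graph" where
  "S_tree l = spider (2 * l # replicate (l + 1) 1)"

definition complete_bipartite :: "nat \<Rightarrow> nat \<Rightarrow> (nat + nat) graph" where
  "complete_bipartite m n =
     ({..<m} <+> {..<n}, {{Inl i, Inr j} | i j. i < m \<and> j < n})"

definition disjoint_union :: "'v graph \<Rightarrow> 'w graph \<Rightarrow> ('v + 'w) graph" where
  "disjoint_union G H =
     (verts G <+> verts H, (\<lambda>e. Inl ` e) ` edges G \<union> (\<lambda>e. Inr ` e) ` edges H)"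

end

theory Submission imports Defs begin

text \<open>The constant 4 s^2 is the gap in the target: \<open>s * (a + b - 2 * s)\<close> lies 2
  s^2 below s (a + b), so losing 1/2 at each of more than 4 s^2 vertices is already too much. In the
  other case 2 s vertices that receive nothing account for exactly the same 2 s^2. Uniqueness also
  settles the connected problem: the only extremal graph is disconnected, so connectedness costs at
  least one edge, and an exchange of edges shows that one is enough. For the other two trees
  bipartiteness keeps the required degrees low, because a new vertex can collide only with vertices
  of its own class. The long leg of the spider has just l vertices in the class opposite to its
  start, so 2 l + 1 neighbours leave l + 1 for the leaves. In P only the leaves at the two ends of
  the path share a class with each other, so one end needs r + t + 1 <= 2 m + 1 neighbours and
  minimum degree m + 1 does for the rest. Sharpness in the divisible cases comes from disjoint
  copies of K_{k,k}: with k = t all degrees are t, and with k = 2 l a spider would need 2 l + 1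
  vertices on one side of a copy.\<close>

text \<open>
  In a \<open>D\<^bsub>s,t\<^esub>\<close>-free bipartite graph no edge joins a vertex of degree more than \<open>s\<close> to one
  of degree more than \<open>t\<close>. Hence edges at a vertex of degree more than \<open>t\<close> can be charged fully to
  their other end, which has degree at most \<open>s\<close>, and all other edges half to each end; every vertex
  gets at most \<open>max s (t / 2)\<close> and high-degree vertices get nothing. For \<open>2 s \<le> t\<close> this is
  the claimed bound. For \<open>t < 2 s\<close>, a vertex gets the full amount \<open>s\<close> only if all its \<open>s\<close>
  neighbours have high degree. If one side has fewer than \<open>s\<close> high vertices, each vertex of the other
  side loses at least 1/2, which is too much since the parts have more than \<open>4 s\<^sup>2\<close> vertices;
  otherwise there are at least \<open>2 s\<close> high vertices, and equality forces the extremal structure.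
  For the other two trees, a graph with more than \<open>m n\<close> edges has a subgraph with minimum degree
  more than \<open>m\<close> and a vertex of degree more than \<open>2 m\<close>, from which the tree is found greedily.
\<close>

subsection \<open>Degrees and charges\<close>

definition nbrs :: "'v graph \<Rightarrow> 'v \<Rightarrow> 'v set" where
  "nbrs G v = {u. {v, u} \<in> edges G}"

abbreviation deg :: "'v graph \<Rightarrow> 'v \<Rightarrow> nat" where
  "deg G v \<equiv> card (nbrs G v)"

text \<open>Speaks of edges only, so the same \<open>A\<close> still works for every subgraph, even
  after vertices have been deleted; a \<open>bipartition\<close> would have to be cut down each
  time.\<close>

definition two_coloured :: "'v graph \<Rightarrow> 'v set \<Rightarrow> bool" where
  "two_coloured G A \<longleftrightarrow> (\<forall>x y. {x, y} \<in> edges G \<longrightarrow> (x \<in> A) \<noteq> (y \<in> A))"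

lemma nbrs_sym: "u \<in> nbrs G v \<longleftrightarrow> v \<in> nbrs G u"
  by (simp add: nbrs_def insert_commute)

lemma edge_verts:
  assumes "simple_graph G" "{x, y} \<in> edges G"
  shows "x \<in> verts G" "y \<in> verts G" "x \<noteq> y"
  using assms unfolding simple_graph_def by fastforce+

lemma edge_endpoints:
  assumes "simple_graph G" "e \<in> edges G"
  obtains x y where "e = {x, y}" "x \<noteq> y" "x \<in> verts G" "y \<in> verts G"
proof -
  have "card e = 2" "e \<subseteq> verts G"
    using assms unfolding simple_graph_def by auto
  then show ?thesis
    using that by (auto simp: card_2_iff)
qed

lemma finite_edges: "simple_graph G \<Longrightarrow> finite (edges G)"
  unfolding simple_graph_def by (rule finite_subset[of _ "Pow (verts G)"]) auto

lemma nbrs_subset: "simple_graph G \<Longrightarrow> nbrs G v \<subseteq> verts G"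
  using edge_verts(2)[of G v] by (auto simp: nbrs_def)

lemma finite_nbrs: "simple_graph G \<Longrightarrow> finite (nbrs G v)"
  using finite_subset[OF nbrs_subset[of G v]] unfolding simple_graph_def by blast

lemma nbrs_two_coloured:
  "\<lbrakk>two_coloured G A; u \<in> nbrs G v\<rbrakk> \<Longrightarrow> (u \<in> A) \<noteq> (v \<in> A)"
  unfolding two_coloured_def nbrs_def by blast

text \<open>Both sides count the ordered pairs of adjacent vertices, by first entry and by
  underlying edge.\<close>

lemma handshake:
  assumes "simple_graph G"
  shows "(\<Sum>v\<in>verts G. deg G v) = 2 * card (edges G)"
proof -
  let ?pairs = "\<lambda>e. {(x, y). {x, y} = e}"
  have fin: "finite (verts G)"
    using assms by (simp add: simple_graph_def)
  have pairs: "finite (?pairs e) \<and> card (?pairs e) = 2" if e: "e \<in> edges G" for e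
  proof -
    obtain x y where "e = {x, y}" "x \<noteq> y"
      using edge_endpoints[OF assms e] by metis
    then have "?pairs e = {(x, y), (y, x)}"
      by (auto simp: doubleton_eq_iff)
    then show ?thesis
      using \<open>x \<noteq> y\<close> by simp
  qed
  have "(\<Sum>v\<in>verts G. deg G v) = card (Sigma (verts G) (nbrs G))"
    using fin finite_nbrs[OF assms] by simp
  also have "Sigma (verts G) (nbrs G) = (\<Union>e\<in>edges G. ?pairs e)"
    using edge_verts[OF assms] by (auto simp: nbrs_def)
  also have "card \<dots> = (\<Sum>e\<in>edges G. card (?pairs e))"
    using pairs finite_edges[OF assms] by (intro card_UN_disjoint) auto
  also have "\<dots> = 2 * card (edges G)"
    using pairs by simp
  finally show ?thesis .
qed

text \<open>Read \<open>c v u\<close> as the share of the edge \<open>{v, u}\<close> that goes to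
  \<open>v\<close>.\<close>

lemma discharging:
  fixes c :: "'v \<Rightarrow> 'v \<Rightarrow> nat"
  assumes G: "simple_graph G"
    and c: "\<And>u v. {u, v} \<in> edges G \<Longrightarrow> 2 \<le> c u v + c v u"
  shows "2 * card (edges G) \<le> (\<Sum>v\<in>verts G. \<Sum>u\<in>nbrs G v. c v u)"
proof -
  have fin: "finite (verts G)"
    using G by (simp add: simple_graph_def)
  have "(\<Sum>v\<in>verts G. \<Sum>u\<in>nbrs G v. c v u) = (\<Sum>v\<in>verts G. \<Sum>u\<in>{u \<in> verts G. {v, u} \<in> edges G}. c v u)"
    using nbrs_subset[OF G] by (intro sum.cong refl) (auto simp: nbrs_def)
  also have "\<dots> = (\<Sum>u\<in>verts G. \<Sum>v\<in>{v \<in> verts G. {v, u} \<in> edges G}. c v u)"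
    using fin by (rule sum.swap_restrict) (rule fin)
  also have "\<dots> = (\<Sum>v\<in>verts G. \<Sum>u\<in>nbrs G v. c u v)"
    using nbrs_subset[OF G] by (intro sum.cong refl) (auto simp: nbrs_def insert_commute)
  finally have swap: "(\<Sum>v\<in>verts G. \<Sum>u\<in>nbrs G v. c v u) = (\<Sum>v\<in>verts G. \<Sum>u\<in>nbrs G v. c u v)" .
  \<comment> \<open>There are twice as many ordered adjacent pairs as edges, and each pair
    contributes at least 2 to the sum of both orders; by \<open>swap\<close> the two orders have
    equal totals.\<close>
  have "2 * (2 * card (edges G)) = (\<Sum>v\<in>verts G. \<Sum>u\<in>nbrs G v. 2)"
    unfolding handshake[OF G, symmetric] by (simp add: sum_distrib_left mult.commute)
  also have "\<dots> \<le> (\<Sum>v\<in>verts G. \<Sum>u\<in>nbrs G v. c v u + c u v)"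
    by (intro sum_mono c) (simp add: nbrs_def)
  also have "\<dots> = 2 * (\<Sum>v\<in>verts G. \<Sum>u\<in>nbrs G v. c v u)"
    using swap by (simp add: sum.distrib)
  finally show ?thesis
    by simp
qed

subsection \<open>Embeddings and isomorphisms\<close>

definition embeds :: "('w \<Rightarrow> 'v) \<Rightarrow> 'w graph \<Rightarrow> 'v graph \<Rightarrow> bool" where
  "embeds f F G \<longleftrightarrow> inj_on f (verts F) \<and> f ` verts F \<subseteq> verts G \<and> (\<forall>e\<in>edges F. f ` e \<in> edges G)"

text \<open>All later copies of trees are built or refuted as injections. The image of such a map is
  again a simple graph because injectivity keeps its edges two-element.\<close>

lemma free_of_iff:
  assumes "simple_graph F"
  shows "free_of F G \<longleftrightarrow> (\<nexists>f. embeds f F G)"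
proof -
  have "embeds f F G" if "subgraph H G" "bij_betw f (verts F) (verts H)" "edges H = (\<lambda>e. f ` e) ` edges F" for f H
    using that unfolding subgraph_def embeds_def bij_betw_def by auto
  moreover have "\<exists>H. subgraph H G \<and> isomorphic F H" if f: "embeds f F G" for f
  proof (intro exI conjI)
    let ?H = "(f ` verts F, (\<lambda>e. f ` e) ` edges F)"
    show "isomorphic F ?H"
      using f unfolding isomorphic_def embeds_def bij_betw_def by auto
    have "card (f ` e) = 2" if "e \<in> edges F" for e
      using that f assms card_image[of f e] inj_on_subset
      unfolding embeds_def simple_graph_def by metis
    then show "subgraph ?H G"
      using f assms unfolding subgraph_def embeds_def simple_graph_def by auto
  qed
  ultimately show ?thesis
    unfolding free_of_def isomorphic_def by metis
qed

lemma embeds_edge: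
  assumes "embeds f F G" "{x, y} \<in> edges F"
  shows "{f x, f y} \<in> edges G"
proof -
  have "f ` {x, y} \<in> edges G"
    using assms unfolding embeds_def by blast
  then show ?thesis by simp
qed

text \<open>Simplicity puts every edge inside \<open>verts G\<close>, where \<open>inv_into\<close>
  undoes \<open>f\<close>.\<close>

lemma isomorphic_sym:
  assumes "simple_graph G" "isomorphic G H"
  shows "isomorphic H G"
proof -
  obtain f where f: "bij_betw f (verts G) (verts H)" "edges H = (\<lambda>e. f ` e) ` edges G"
    using assms unfolding isomorphic_def by blast
  let ?g = "inv_into (verts G) f"
  have "?g ` f ` e = e" if "e \<in> edges G" for e
    using that assms f(1) unfolding simple_graph_def bij_betw_def by (simp add: inv_into_image_cancel)
  then have "(\<lambda>e. ?g ` e) ` edges H = edges G"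
    unfolding f(2) image_image by simp
  then show ?thesis
    unfolding isomorphic_def using bij_betw_inv_into[OF f(1)] by metis
qed

lemma isomorphic_simple_graph:
  assumes "simple_graph G" "isomorphic G H"
  shows "simple_graph H"
proof -
  obtain f where f: "bij_betw f (verts G) (verts H)" "edges H = (\<lambda>e. f ` e) ` edges G"
    using assms unfolding isomorphic_def by blast
  have "card (f ` e) = 2" if "e \<in> edges G" for e
    using that f(1) assms card_image[of f e] inj_on_subset
    unfolding bij_betw_def simple_graph_def by metis
  then show ?thesis
    using assms(1) f(2) bij_betw_imp_surj_on[OF f(1), symmetric] unfolding simple_graph_def by fastforce
qed

lemma isomorphic_bipartite_graph:
  assumes G: "bipartite_graph a b G" and iso: "isomorphic G H"
  shows "bipartite_graph a b H"
proof -
  have simple: "simple_graph G"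
    using G by (simp add: bipartite_graph_def)
  obtain A B where AB: "bipartition G A B" "card A = a" "card B = b"
    using G by (auto simp: bipartite_graph_def)
  obtain f where f: "bij_betw f (verts G) (verts H)" "edges H = (\<lambda>e. f ` e) ` edges G"
    using iso unfolding isomorphic_def by blast
  have sub: "A \<union> B = verts G" "A \<inter> B = {}"
    using AB(1) by (auto simp: bipartition_def)
  have inj: "inj_on f (A \<union> B)"
    using f(1) sub by (simp add: bij_betw_def)
  have "f ` A \<inter> f ` B = {}"
    using inj sub(2) inj_on_image_Int[OF inj, of A B] by auto
  moreover have "f ` A \<union> f ` B = verts H"
    using f(1) sub(1) by (metis bij_betw_imp_surj_on image_Un)
  moreover have "\<exists>x\<in>f ` A. \<exists>y\<in>f ` B. e = {x, y}" if "e \<in> edges H" for e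
    using that AB(1) unfolding f(2) bipartition_def by fastforce
  ultimately have "bipartition H (f ` A) (f ` B)"
    by (simp add: bipartition_def)
  moreover have "card (f ` A) = a" "card (f ` B) = b"
    using inj AB by (auto simp: inj_on_Un card_image)
  ultimately show ?thesis
    using isomorphic_simple_graph[OF simple iso] unfolding bipartite_graph_def by blast
qed

lemma isomorphic_card_edges:
  assumes "simple_graph G" "isomorphic G H"
  shows "card (edges H) = card (edges G)"
proof -
  obtain f where f: "bij_betw f (verts G) (verts H)" "edges H = (\<lambda>e. f ` e) ` edges G"
    using assms unfolding isomorphic_def by blast
  have "inj_on (\<lambda>e. f ` e) (edges G)"
    using f(1) assms(1) unfolding bij_betw_def simple_graph_def
    by (intro inj_on_image inj_on_subset[of f "verts G" "\<Union> (edges G)"]) auto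
  then show ?thesis
    by (simp add: f(2) card_image)
qed

lemma isomorphic_free_of:
  assumes F: "simple_graph F" and G: "simple_graph G" and "isomorphic G H" "free_of F G"
  shows "free_of F H"
proof -
  obtain g where g: "bij_betw g (verts H) (verts G)" "edges G = (\<lambda>e. g ` e) ` edges H"
    using isomorphic_sym[OF G assms(3)] unfolding isomorphic_def by blast
  have "embeds (g \<circ> f) F G" if "embeds f F H" for f
    unfolding embeds_def
  proof (intro conjI ballI)
    show "inj_on (g \<circ> f) (verts F)"
      using that g(1) unfolding embeds_def bij_betw_def by (auto intro: comp_inj_on inj_on_subset)
    show "(g \<circ> f) ` verts F \<subseteq> verts G"
      using that bij_betw_imp_surj_on[OF g(1), symmetric] unfolding embeds_def image_comp[symmetric]
      by (metis image_mono)
    show "(g \<circ> f) ` e \<in> edges G" if "e \<in> edges F" for e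
      using \<open>embeds f F H\<close> that unfolding embeds_def g(2) image_comp[symmetric] by blast
  qed
  then show ?thesis
    using assms(4) unfolding free_of_iff[OF F] by blast
qed

lemma isomorphic_connected_graph:
  assumes "isomorphic G H" "connected_graph G"
  shows "connected_graph H"
proof -
  obtain f where f: "bij_betw f (verts G) (verts H)" "edges H = (\<lambda>e. f ` e) ` edges G"
    using assms unfolding isomorphic_def by blast
  have "{f u, f v} \<in> edges H" if "{u, v} \<in> edges G" for u v
    unfolding f(2) by (rule image_eqI[OF _ that]) simp
  then have edge: "(f u, f v) \<in> {(u, v). {u, v} \<in> edges H}" if "(u, v) \<in> {(u, v). {u, v} \<in> edges G}" for u v
    using that by blast
  have "(f x, f y) \<in> {(u, v). {u, v} \<in> edges H}\<^sup>*"
    if "(x, y) \<in> {(u, v). {u, v} \<in> edges G}\<^sup>*" for x y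
    using that
  proof (induction rule: rtrancl_induct)
    case (step y z)
    then show ?case
      using edge by (meson rtrancl_into_rtrancl)
  qed simp
  moreover have "verts H = f ` verts G"
    using f(1) by (simp add: bij_betw_def)
  ultimately show ?thesis
    using assms(2) unfolding connected_graph_def by auto
qed

text \<open>Carries the constructions, which live on pair and sum types, over to the
  \<open>nat\<close> graphs that \<open>ex_b\<close> and \<open>ex_bc\<close> range over.\<close>

lemma nat_copy:
  assumes "simple_graph (G :: 'v graph)"
  obtains H :: "nat graph" where "isomorphic G H"
proof -
  obtain f :: "'v \<Rightarrow> nat" where f: "inj_on f (verts G)"
    using finite_imp_inj_to_nat_seg[of "verts G"] assms unfolding simple_graph_def by auto
  have "isomorphic G (f ` verts G, (\<lambda>e. f ` e) ` edges G)"
    using f unfolding isomorphic_def bij_betw_def by auto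
  then show ?thesis
    using that by blast
qed

section \<open>Bipartitions, and upper and lower bounds for the maxima\<close>

lemma bipartite_two_coloured:
  assumes "bipartition G A B"
  shows "two_coloured G A"
  unfolding two_coloured_def
proof (intro allI impI)
  fix x y assume "{x, y} \<in> edges G"
  then obtain p q where "p \<in> A" "q \<in> B" "{x, y} = {p, q}"
    using assms unfolding bipartition_def by metis
  then show "(x \<in> A) \<noteq> (y \<in> A)"
    using assms unfolding bipartition_def by (auto simp: doubleton_eq_iff)
qed

lemma bipartition_finite:
  assumes "simple_graph G" "bipartition G A B"
  shows "finite A" "finite B" "card (verts G) = card A + card B"
proof -
  show fin: "finite A" "finite B"
    using assms finite_subset unfolding simple_graph_def bipartition_def by (metis Un_upper1 Un_upper2)+
  show "card (verts G) = card A + card B"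
    using assms fin unfolding bipartition_def by (metis card_Un_disjoint)
qed

text \<open>A crude bound whose purpose is to make the sets under \<open>Max\<close> finite.\<close>

lemma bipartite_card_edges_le:
  assumes "bipartite_graph a b G"
  shows "card (edges G) \<le> 2 ^ (a + b)"
proof -
  have G: "simple_graph G" "card (verts G) = a + b"
    using assms bipartition_finite unfolding bipartite_graph_def by blast+
  have "card (edges G) \<le> card (Pow (verts G))"
    using G(1) unfolding simple_graph_def by (intro card_mono) auto
  then show ?thesis
    using G by (simp add: card_Pow simple_graph_def)
qed

lemma finite_ex_set:
  "finite {card (edges G) | G :: nat graph. bipartite_graph a b G \<and> P G}"
proof (rule finite_subset[OF _ finite_atMost])
  show "{card (edges G) | G :: nat graph. bipartite_graph a b G \<and> P G} \<subseteq> {..2 ^ (a + b)}"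
    using bipartite_card_edges_le by blast
qed

lemma card_edges_le_ex_b:
  assumes "simple_graph F" "bipartite_graph a b (G :: 'v graph)" "free_of F G"
  shows "card (edges G) \<le> ex_b a b F"
proof -
  have G: "simple_graph G"
    using assms(2) by (simp add: bipartite_graph_def)
  obtain H :: "nat graph" where H: "isomorphic G H"
    using nat_copy[OF G] .
  have "card (edges H) \<le> ex_b a b F"
    using isomorphic_bipartite_graph[OF assms(2) H] isomorphic_free_of[OF assms(1) G H assms(3)]
    unfolding ex_b_def by (intro Max_ge finite_ex_set) blast
  then show ?thesis
    using isomorphic_card_edges[OF G H] by simp
qed

lemma card_edges_le_ex_bc:
  assumes "simple_graph F" "bipartite_graph a b (G :: 'v graph)" "connected_graph G" "free_of F G"
  shows "card (edges G) \<le> ex_bc a b F"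
proof -
  have G: "simple_graph G"
    using assms(2) by (simp add: bipartite_graph_def)
  obtain H :: "nat graph" where H: "isomorphic G H"
    using nat_copy[OF G] .
  have "card (edges H) \<le> ex_bc a b F"
    unfolding ex_bc_def
  proof (intro Max_ge finite_ex_set CollectI exI conjI)
    show "bipartite_graph a b H" "connected_graph H" "free_of F H"
      using isomorphic_bipartite_graph[OF assms(2) H] isomorphic_connected_graph[OF H assms(3)]
        isomorphic_free_of[OF assms(1) G H assms(4)] by auto
  qed simp
  then show ?thesis
    using isomorphic_card_edges[OF G H] by simp
qed

lemma empty_free_of:
  assumes "simple_graph F" "edges F \<noteq> {}"
  shows "free_of F (V, {})"
proof -
  obtain e where "e \<in> edges F"
    using assms(2) by blast
  then have "\<not> embeds f F (V, {})" for f
    unfolding embeds_def by auto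
  then show ?thesis
    unfolding free_of_iff[OF assms(1)] by blast
qed

lemma ex_b_leI:
  assumes F: "simple_graph F" "edges F \<noteq> {}"
    and bound: "\<And>G :: nat graph. \<lbrakk>bipartite_graph a b G; free_of F G\<rbrakk> \<Longrightarrow> card (edges G) \<le> n"
  shows "ex_b a b F \<le> n"
proof -
  \<comment> \<open>\<open>Max\<close> is unspecified on the empty set; the edgeless graph shows
    that the set is nonempty.\<close>
  let ?E = "({..<a + b}, {}) :: nat graph"
  have "bipartition ?E {..<a} {a..<a + b}"
    unfolding bipartition_def by (simp add: ivl_disj_un ivl_disj_int)
  moreover have "simple_graph ?E"
    by (simp add: simple_graph_def)
  ultimately have "bipartite_graph a b ?E"
    unfolding bipartite_graph_def by (intro conjI exI[of _ "{..<a}"] exI[of _ "{a..<a + b}"]) simp_all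
  then have "card (edges ?E) \<in> {card (edges G) | G :: nat graph. bipartite_graph a b G \<and> free_of F G}"
    using empty_free_of[OF F] by blast
  then show ?thesis
    unfolding ex_b_def using bound by (subst Max_le_iff[OF finite_ex_set]) auto
qed

text \<open>Among connected graphs no edgeless witness is at hand, so the caller supplies a graph
  \<open>G\<close> showing that the set under \<open>Max\<close> is nonempty.\<close>

lemma ex_bc_leI:
  assumes F: "simple_graph F"
    and G: "bipartite_graph a b (G :: 'v graph)" "connected_graph G" "free_of F G"
    and bound: "\<And>G :: nat graph. \<lbrakk>bipartite_graph a b G; connected_graph G; free_of F G\<rbrakk> \<Longrightarrow> card (edges G) \<le> n"
  shows "ex_bc a b F \<le> n"
proof -
  have simple: "simple_graph G"
    using G(1) by (simp add: bipartite_graph_def)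
  obtain H :: "nat graph" where H: "isomorphic G H"
    using nat_copy[OF simple] .
  have "card (edges H) \<in> {card (edges G) | G :: nat graph. bipartite_graph a b G \<and> connected_graph G \<and> free_of F G}"
  proof (intro CollectI exI conjI)
    show "bipartite_graph a b H" "connected_graph H" "free_of F H"
      using isomorphic_bipartite_graph[OF G(1) H] isomorphic_connected_graph[OF H G(2)]
        isomorphic_free_of[OF F simple H G(3)] by auto
  qed simp
  then show ?thesis
    unfolding ex_bc_def using bound by (subst Max_le_iff[OF finite_ex_set]) auto
qed

subsection \<open>Dense subgraphs\<close>

lemma subgraph_trans: "\<lbrakk>subgraph H G; subgraph G K\<rbrakk> \<Longrightarrow> subgraph H K"
  unfolding subgraph_def by blast

lemma free_of_subgraph: "\<lbrakk>subgraph H G; free_of F G\<rbrakk> \<Longrightarrow> free_of F H"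
  using subgraph_trans unfolding free_of_def by blast

lemma two_coloured_subgraph: "\<lbrakk>subgraph H G; two_coloured G A\<rbrakk> \<Longrightarrow> two_coloured H A"
  unfolding two_coloured_def subgraph_def by blast

text \<open>Deleting a vertex of degree at most \<open>m\<close> removes one vertex and at most
  \<open>m\<close> edges, which preserves the inequality; repeat until no such vertex is
  left.\<close>

lemma dense_subgraph:
  assumes "simple_graph G" "m * card (verts G) < card (edges G)"
  shows "\<exists>H. subgraph H G \<and> m * card (verts H) < card (edges H) \<and> (\<forall>v\<in>verts H. m < deg H v)"
  using assms
proof (induction "card (verts G)" arbitrary: G rule: less_induct)
  case less
  note G = less.prems(1)
  show ?case
  proof (cases "\<forall>v\<in>verts G. m < deg G v")
    case True
    then show ?thesis
      using less.prems by (intro exI[of _ G]) (simp add: subgraph_def)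
  next
    case False
    then obtain v where v: "v \<in> verts G" "deg G v \<le> m"
      by (auto simp: not_less)
    let ?H = "(verts G - {v}, {e \<in> edges G. v \<notin> e})"
    have H: "subgraph ?H G"
      using G by (auto simp: subgraph_def simple_graph_def)
    have "edges G \<subseteq> edges ?H \<union> (\<lambda>u. {v, u}) ` nbrs G v"
    proof
      fix e assume e: "e \<in> edges G"
      obtain x y where "e = {x, y}"
        using edge_endpoints[OF G e] by metis
      then show "e \<in> edges ?H \<union> (\<lambda>u. {v, u}) ` nbrs G v"
        using e by (auto simp: nbrs_def insert_commute)
    qed
    then have "card (edges G) \<le> card (edges ?H \<union> (\<lambda>u. {v, u}) ` nbrs G v)"
      using finite_edges[OF G] finite_nbrs[OF G] by (intro card_mono) auto
    also have "\<dots> \<le> card (edges ?H) + card ((\<lambda>u. {v, u}) ` nbrs G v)"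
      by (rule card_Un_le)
    also have "card ((\<lambda>u. {v, u}) ` nbrs G v) \<le> m"
      using card_image_le[OF finite_nbrs[OF G]] v(2) le_trans by blast
    finally have card_edges: "card (edges G) \<le> card (edges ?H) + m"
      by simp
    have fin: "finite (verts G)"
      using G by (simp add: simple_graph_def)
    then have "card (verts G) = Suc (card (verts ?H))"
      using card_Suc_Diff1[OF _ v(1)] by simp
    then have smaller: "card (verts ?H) < card (verts G)" "m * card (verts ?H) < card (edges ?H)"
      using less.prems(2) card_edges by simp_all
    have "simple_graph ?H"
      using H by (simp add: subgraph_def)
    from less.hyps[OF smaller(1) this smaller(2)] show ?thesis
      using subgraph_trans[OF _ H] by blast
  qed
qed

text \<open>By the handshake identity the average degree exceeds \<open>2 * m\<close>.\<close>

lemma exists_high_degree: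
  assumes G: "simple_graph G" "m * card (verts G) < card (edges G)"
  shows "\<exists>v\<in>verts G. 2 * m < deg G v"
proof (rule ccontr)
  assume "\<not> ?thesis"
  then have "(\<Sum>v\<in>verts G. deg G v) \<le> (\<Sum>v\<in>verts G. 2 * m)"
    by (intro sum_mono) (auto simp: not_less)
  then show False
    using G by (simp add: handshake mult.commute)
qed

text \<open>The indices start at 1 because the trees number their leaves from 1 and reserve 0 for
  the centre.\<close>

lemma obtain_selection:
  assumes "finite X" "k \<le> card X"
  obtains g :: "nat \<Rightarrow> 'a" where "inj_on g {1..k}" "\<And>j. \<lbrakk>0 < j; j \<le> k\<rbrakk> \<Longrightarrow> g j \<in> X"
proof -
  have "card {1..k} \<le> card X"
    using assms(2) by simp
  from card_le_inj[OF _ assms(1) this] obtain g where "g ` {1..k} \<subseteq> X" "inj_on g {1..k}"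
    by auto
  then show ?thesis
    using that[of g] by (simp add: image_subset_iff)
qed

text \<open>A row is one vertex of the central path, sent to \<open>x\<close>, together with its
  leaves, sent by \<open>g\<close>.\<close>

lemma inj_on_row:
  assumes "inj_on g {1..k :: nat}" "\<And>j. \<lbrakk>0 < j; j \<le> k\<rbrakk> \<Longrightarrow> g j \<noteq> x"
    and f: "\<And>j. f (i, j) = (if j = 0 then x else g j)"
  shows "inj_on f ({i} \<times> {0..k})"
proof (rule inj_onI)
  fix y z assume yz: "y \<in> {i} \<times> {0..k}" "z \<in> {i} \<times> {0..k}" "f y = f z"
  obtain m n where mn: "y = (i, m)" "z = (i, n)" "m \<le> k" "n \<le> k"
    using yz by auto
  show "y = z"
    using inj_onD[OF assms(1), of m n] assms(2)[of m] assms(2)[of n] yz(3) mn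
    unfolding mn f by (auto split: if_splits)
qed

lemma embeds_deg_le:
  assumes F: "simple_graph F" and G: "simple_graph G" and f: "embeds f F G"
  shows "deg F x \<le> deg G (f x)"
proof -
  have "card (f ` nbrs F x) = deg F x"
    using f nbrs_subset[OF F] by (metis card_image embeds_def inj_on_subset)
  moreover have "f ` nbrs F x \<subseteq> nbrs G (f x)"
    using embeds_edge[OF f] by (auto simp: nbrs_def)
  ultimately show ?thesis
    using card_mono[OF finite_nbrs[OF G]] by metis
qed

subsection \<open>Double stars\<close>

lemma simple_double_star: "simple_graph (double_star s t)"
proof -
  have "e \<subseteq> verts (double_star s t) \<and> card e = 2" if "e \<in> edges (double_star s t)" for e
    using that by (auto simp: double_star_def)
  then show ?thesis
    by (auto simp: simple_graph_def double_star_def)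
qed

lemma edges_double_star_nonempty: "edges (double_star s t) \<noteq> {}"
  by (simp add: double_star_def)

lemma deg_double_star:
  "Suc s \<le> deg (double_star s t) (0, 0)" "Suc t \<le> deg (double_star s t) (1, 0)"
proof -
  have "insert (1, 0) ((\<lambda>j. (0, j)) ` {1..s}) \<subseteq> nbrs (double_star s t) (0, 0)"
    by (auto simp: nbrs_def double_star_def)
  from card_mono[OF finite_nbrs[OF simple_double_star] this]
  show "Suc s \<le> deg (double_star s t) (0, 0)"
    by (subst (asm) card_insert_disjoint) (auto simp: card_image inj_on_def)
  have "insert (0, 0) ((\<lambda>j. (1, j)) ` {1..t}) \<subseteq> nbrs (double_star s t) (1, 0)"
    by (auto simp: nbrs_def double_star_def insert_commute)
  from card_mono[OF finite_nbrs[OF simple_double_star] this]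
  show "Suc t \<le> deg (double_star s t) (1, 0)"
    by (subst (asm) card_insert_disjoint) (auto simp: card_image inj_on_def)
qed

text \<open>The two centres of a copy are adjacent and have degrees at least s + 1 and t +
  1.\<close>

lemma double_star_freeI:
  assumes G: "simple_graph G"
    and deg: "\<And>u v. {u, v} \<in> edges G \<Longrightarrow> deg G u \<le> s \<or> deg G v \<le> t"
  shows "free_of (double_star s t) G"
proof -
  have False if f: "embeds f (double_star s t) G" for f
  proof -
    have "{f (0, 0), f (1, 0)} \<in> edges G"
      using f by (rule embeds_edge) (simp add: double_star_def)
    moreover have "Suc s \<le> deg G (f (0, 0))" "Suc t \<le> deg G (f (1, 0))"
      using deg_double_star embeds_deg_le[OF simple_double_star G f] le_trans by blast+
    ultimately show False
      using deg by fastforce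
  qed
  then show ?thesis
    using free_of_iff[OF simple_double_star] by blast
qed

text \<open>In a bipartite graph the ends of an edge have no common neighbour, so leaves chosen
  independently at \<open>u\<close> and at \<open>v\<close> never collide.\<close>

lemma double_star_freeD:
  assumes G: "simple_graph G" "two_coloured G A"
    and free: "free_of (double_star s t) G" and uv: "{u, v} \<in> edges G"
  shows "deg G u \<le> s \<or> deg G v \<le> t"
proof (rule ccontr)
  assume "\<not> ?thesis"
  then have deg: "s < deg G u" "t < deg G v"
    by auto
  have nbr: "v \<in> nbrs G u" "u \<in> nbrs G v"
    using uv by (auto simp: nbrs_def insert_commute)
  then have "s \<le> card (nbrs G u - {v})" "t \<le> card (nbrs G v - {u})"
    using deg finite_nbrs[OF G(1)] by auto
  then obtain g h where g: "inj_on g {1..s}" "\<And>j. \<lbrakk>0 < j; j \<le> s\<rbrakk> \<Longrightarrow> g j \<in> nbrs G u - {v}"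
    and h: "inj_on h {1..t}" "\<And>j. \<lbrakk>0 < j; j \<le> t\<rbrakk> \<Longrightarrow> h j \<in> nbrs G v - {u}"
    using obtain_selection[OF finite_Diff[OF finite_nbrs[OF G(1)]]] by metis
  define f where "f = (\<lambda>(i :: nat, j). if i = 0 then (if j = 0 then u else g j) else (if j = 0 then v else h j))"
  have uv_col: "(u \<in> A) \<noteq> (v \<in> A)"
    using uv G(2) unfolding two_coloured_def by blast
  have g_edge: "{u, g j} \<in> edges G" "(g j \<in> A) = (v \<in> A)" "g j \<noteq> v" if "0 < j" "j \<le> s" for j
    using g(2)[OF that] nbrs_two_coloured[OF G(2), of "g j" u] uv_col by (auto simp: nbrs_def)
  have h_edge: "{v, h j} \<in> edges G" "(h j \<in> A) = (u \<in> A)" "h j \<noteq> u" if "0 < j" "j \<le> t" for j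
    using h(2)[OF that] nbrs_two_coloured[OF G(2), of "h j" v] uv_col by (auto simp: nbrs_def)
  have "embeds f (double_star s t) G"
    unfolding embeds_def
  proof (intro conjI ballI)
    have f0: "f (0, j) = (if j = 0 then u else g j)" and f1: "f (1, j) = (if j = 0 then v else h j)" for j
      by (simp_all add: f_def)
    have col: "(f (0, j) \<in> A) = (if j = 0 then u \<in> A else v \<in> A)" if "j \<le> s" for j
      using g_edge(2)[of j] that unfolding f0 by simp
    have col': "(f (1, j) \<in> A) = (if j = 0 then v \<in> A else u \<in> A)" if "j \<le> t" for j
      using h_edge(2)[of j] that unfolding f1 by simp
    have "g j \<noteq> u" if "0 < j" "j \<le> s" for j
      using g_edge(2)[OF that] uv_col by auto
    from inj_on_row[OF g(1) this f0] have "inj_on f ({0} \<times> {0..s})" .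
    moreover have "h j \<noteq> v" if "0 < j" "j \<le> t" for j
      using h_edge(2)[OF that] uv_col by auto
    from inj_on_row[OF h(1) this f1] have "inj_on f ({1} \<times> {0..t})" .
    \<comment> \<open>Colours separate centre from centre and leaf from leaf; a leaf and the
      opposite centre differ because that centre was removed before the leaves were
      selected.\<close>
    moreover have "f (0, i) \<noteq> f (1, j)" if "i \<le> s" "j \<le> t" for i j
      using col[OF that(1)] col'[OF that(2)] g_edge(3)[of i] h_edge(3)[of j] uv_col that
      unfolding f0 f1 by (auto split: if_splits)
    ultimately show "inj_on f (verts (double_star s t))"
      unfolding double_star_def fst_conv inj_on_Un by fastforce
    show "f ` verts (double_star s t) \<subseteq> verts G"
      using edge_verts[OF G(1) uv] edge_verts(2)[OF G(1) g_edge(1)] edge_verts(2)[OF G(1) h_edge(1)]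
      by (auto simp: f_def double_star_def)
    show "f ` e \<in> edges G" if "e \<in> edges (double_star s t)" for e
      using that uv g_edge(1) h_edge(1) by (auto simp: f_def double_star_def)
  qed
  then show False
    using free free_of_iff[OF simple_double_star] by blast
qed

lemma inj_on_Un_disjoint:
  "\<lbrakk>inj_on f X; inj_on f Y; f ` X \<inter> f ` Y = {}\<rbrakk> \<Longrightarrow> inj_on f (X \<union> Y)"
  unfolding inj_on_Un by blast

subsection \<open>The tree P\<close>

lemma simple_P_tree: "simple_graph (P_tree r s t)"
proof -
  have "e \<subseteq> verts (P_tree r s t) \<and> card e = 2" if "e \<in> edges (P_tree r s t)" for e
    using that by (auto simp: P_tree_def)
  then show ?thesis
    by (auto simp: simple_graph_def P_tree_def)
qed

lemma edges_P_tree_nonempty: "edges (P_tree r s t) \<noteq> {}"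
  by (simp add: P_tree_def)

text \<open>Leaves of \<open>v\<close> lie in the class of \<open>u\<close> and \<open>w\<close>,
  while leaves of \<open>u\<close> and of \<open>w\<close> both lie in the class of
  \<open>v\<close>. The leaves of \<open>w\<close> are therefore chosen last, avoiding
  \<open>v\<close> and the \<open>r\<close> leaves of \<open>u\<close>, which explains the bound on
  \<open>deg G w\<close>.\<close>

lemma P_tree_embeds:
  assumes G: "simple_graph G" "two_coloured G A"
    and uv: "{v, u} \<in> edges G" and wv: "{v, w} \<in> edges G" and "u \<noteq> w"
    and deg: "r < deg G u" "Suc s < deg G v" "r + t < deg G w"
  shows "\<exists>f. embeds f (P_tree r s t) G"
proof -
  note fin = finite_nbrs[OF G(1)]
  have nbr: "u \<in> nbrs G v" "w \<in> nbrs G v" "v \<in> nbrs G u" "v \<in> nbrs G w"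
    using uv wv by (auto simp: nbrs_def insert_commute)
  have "r \<le> card (nbrs G u - {v})"
    using nbr deg(1) fin by simp
  then obtain g where g: "inj_on g {1..r}" "\<And>j. \<lbrakk>0 < j; j \<le> r\<rbrakk> \<Longrightarrow> g j \<in> nbrs G u - {v}"
    using obtain_selection[OF finite_Diff[OF fin]] by metis
  have "card (nbrs G v - {u, w}) = deg G v - card {u, w}"
    using nbr fin by (intro card_Diff_subset) auto
  then have "s \<le> card (nbrs G v - {u, w})"
    using \<open>u \<noteq> w\<close> deg(2) by simp
  then obtain h where h: "inj_on h {1..s}" "\<And>j. \<lbrakk>0 < j; j \<le> s\<rbrakk> \<Longrightarrow> h j \<in> nbrs G v - {u, w}"
    using obtain_selection[OF finite_Diff[OF fin]] by metis
  have "card (g ` {1..r}) \<le> r"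
    using card_image_le[of "{1..r}" g] by simp
  then have "t \<le> card (nbrs G w - {v} - g ` {1..r})"
    using diff_card_le_card_Diff[of "g ` {1..r}" "nbrs G w - {v}"] nbr deg(3) fin by simp
  then obtain k where k: "inj_on k {1..t}" "\<And>j. \<lbrakk>0 < j; j \<le> t\<rbrakk> \<Longrightarrow> k j \<in> nbrs G w - {v} - g ` {1..r}"
    using obtain_selection[OF finite_Diff[OF finite_Diff[OF fin]]] by metis
  define f where "f = (\<lambda>(i :: nat, j). if i = 0 then (if j = 0 then u else g j)
    else if i = 1 then (if j = 0 then v else h j) else (if j = 0 then w else k j))"
  have col: "(u \<in> A) \<noteq> (v \<in> A)" "(w \<in> A) \<noteq> (v \<in> A)"
    using nbrs_two_coloured[OF G(2) nbr(1)] nbrs_two_coloured[OF G(2) nbr(2)] by auto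
  have g_edge: "{u, g j} \<in> edges G" "(g j \<in> A) = (v \<in> A)" "g j \<noteq> v" if "0 < j" "j \<le> r" for j
    using g(2)[OF that] nbrs_two_coloured[OF G(2), of "g j" u] col by (auto simp: nbrs_def)
  have h_edge: "{v, h j} \<in> edges G" "(h j \<in> A) \<noteq> (v \<in> A)" "h j \<noteq> u" "h j \<noteq> w" if "0 < j" "j \<le> s" for j
    using h(2)[OF that] nbrs_two_coloured[OF G(2), of "h j" v] by (auto simp: nbrs_def)
  have k_edge: "{w, k j} \<in> edges G" "(k j \<in> A) = (v \<in> A)" "k j \<noteq> v" "k j \<notin> g ` {1..r}" if "0 < j" "j \<le> t" for j
    using k(2)[OF that] nbrs_two_coloured[OF G(2), of "k j" w] col by (auto simp: nbrs_def)
  have f0: "f (0, j) = (if j = 0 then u else g j)" and f1: "f (1, j) = (if j = 0 then v else h j)"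
    and f2: "f (2, j) = (if j = 0 then w else k j)" for j
    by (simp_all add: f_def)
  have col0: "(f (0, j) \<in> A) = (if j = 0 then u \<in> A else v \<in> A)" if "j \<le> r" for j
    using g_edge(2)[of j] that unfolding f0 by simp
  have col1: "(f (1, j) \<in> A) = (if j = 0 then v \<in> A else u \<in> A)" if "j \<le> s" for j
    using h_edge(2)[of j] that col unfolding f1 by auto
  have col2: "(f (2, j) \<in> A) = (if j = 0 then w \<in> A else v \<in> A)" if "j \<le> t" for j
    using k_edge(2)[of j] that unfolding f2 by simp
  have "embeds f (P_tree r s t) G"
    unfolding embeds_def
  proof (intro conjI ballI)
    have "g j \<noteq> u" if "0 < j" "j \<le> r" for j
      using g_edge(2)[OF that] col by auto
    from inj_on_row[OF g(1) this f0] have "inj_on f ({0} \<times> {0..r})" .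
    moreover have "h j \<noteq> v" if "0 < j" "j \<le> s" for j
      using h_edge(2)[OF that] by auto
    from inj_on_row[OF h(1) this f1] have "inj_on f ({1} \<times> {0..s})" .
    moreover have "k j \<noteq> w" if "0 < j" "j \<le> t" for j
      using k_edge(2)[OF that] col by auto
    from inj_on_row[OF k(1) this f2] have "inj_on f ({2} \<times> {0..t})" .
    moreover have "f (0, i) \<noteq> f (1, j)" if "i \<le> r" "j \<le> s" for i j
      using col0[OF that(1)] col1[OF that(2)] g_edge(3)[of i] h_edge(3)[of j] col that
      unfolding f0 f1 by (auto split: if_splits)
    then have "f ` ({0} \<times> {0..r}) \<inter> f ` ({1} \<times> {0..s}) = {}"
      by fastforce
    \<comment> \<open>Here colours do not separate the leaves; the choice of \<open>k\<close>
      outside the image of \<open>g\<close> does.\<close>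
    moreover have "f (0, i) \<noteq> f (2, j)" if "i \<le> r" "j \<le> t" for i j
    proof (cases "i = 0 \<or> j = 0")
      case True
      then show ?thesis
        using col0[OF that(1)] col2[OF that(2)] col \<open>u \<noteq> w\<close> that
        unfolding f0 f2 by (auto split: if_splits)
    next
      case False
      then have "g i \<in> g ` {1..r}" "k j \<notin> g ` {1..r}"
        using k_edge(4)[of j] that by auto
      then show ?thesis
        using False unfolding f0 f2 by auto
    qed
    then have "f ` ({0} \<times> {0..r}) \<inter> f ` ({2} \<times> {0..t}) = {}"
      by fastforce
    moreover have "f (1, i) \<noteq> f (2, j)" if "i \<le> s" "j \<le> t" for i j
      using col1[OF that(1)] col2[OF that(2)] h_edge(4)[of i] k_edge(3)[of j] col that
      unfolding f1 f2 by (auto split: if_splits)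
    then have "f ` ({1} \<times> {0..s}) \<inter> f ` ({2} \<times> {0..t}) = {}"
      by fastforce
    ultimately show "inj_on f (verts (P_tree r s t))"
      unfolding P_tree_def fst_conv by (intro inj_on_Un_disjoint) (simp_all only: image_Un Int_Un_distrib2 Un_empty)
    show "f ` verts (P_tree r s t) \<subseteq> verts G"
      using edge_verts[OF G(1) uv] edge_verts[OF G(1) wv] edge_verts(2)[OF G(1) g_edge(1)]
        edge_verts(2)[OF G(1) h_edge(1)] edge_verts(2)[OF G(1) k_edge(1)]
      by (auto simp: f_def P_tree_def)
    show "f ` e \<in> edges G" if "e \<in> edges (P_tree r s t)" for e
      using that uv wv g_edge(1) h_edge(1) k_edge(1)
      by (auto simp: f_def P_tree_def insert_commute)
  qed
  then show ?thesis by blast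
qed

text \<open>In the dense subgraph take a vertex \<open>w\<close> of degree above
  \<open>2 * m\<close>, which is at least r + t, then any neighbour \<open>v\<close> and another
  neighbour \<open>u\<close> of \<open>v\<close>. Minimum degree \<open>m + 1\<close> is enough for
  \<open>u\<close> since \<open>r \<le> m\<close>, and for \<open>v\<close> since
  \<open>s < m\<close>.\<close>

lemma P_tree_free_card_edges_le:
  assumes G: "simple_graph G" "two_coloured G A" and free: "free_of (P_tree r s t) G"
    and m: "r \<le> m" "t \<le> m" "s < m"
  shows "card (edges G) \<le> m * card (verts G)"
proof (rule ccontr)
  assume "\<not> ?thesis"
  then obtain H where H: "subgraph H G" "m * card (verts H) < card (edges H)"
    and min_deg: "\<And>v. v \<in> verts H \<Longrightarrow> m < deg H v"
    using dense_subgraph[OF G(1)] by (meson not_le)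
  have simple: "simple_graph H"
    using H(1) by (simp add: subgraph_def)
  obtain w where w: "w \<in> verts H" "2 * m < deg H w"
    using exists_high_degree[OF simple H(2)] by blast
  then have "nbrs H w \<noteq> {}"
    by auto
  then obtain v where v: "v \<in> nbrs H w"
    by blast
  then have "v \<in> verts H" "w \<in> nbrs H v"
    using nbrs_subset[OF simple] nbrs_sym by fast+
  moreover have "nbrs H v \<noteq> {w}"
    using min_deg[OF \<open>v \<in> verts H\<close>] m(3) by auto
  ultimately obtain u where u: "u \<in> nbrs H v" "u \<noteq> w"
    by blast
  then have "u \<in> verts H"
    using nbrs_subset[OF simple] by blast
  have "\<exists>f. embeds f (P_tree r s t) H"
  proof (rule P_tree_embeds[OF simple two_coloured_subgraph[OF H(1) G(2)] _ _ u(2)])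
    show "{v, u} \<in> edges H" "{v, w} \<in> edges H"
      using u(1) \<open>w \<in> nbrs H v\<close> by (simp_all add: nbrs_def)
    show "r < deg H u" "Suc s < deg H v" "r + t < deg H w"
      using min_deg[OF \<open>u \<in> verts H\<close>] min_deg[OF \<open>v \<in> verts H\<close>] w(2) m by auto
  qed
  then show False
    using free_of_subgraph[OF H(1) free] free_of_iff[OF simple_P_tree] by blast
qed

subsection \<open>The spider\<close>

text \<open>Separates the long leg, which has index 0 and contains the common vertex
  \<open>None\<close>, from the pendant edges with indices from 1 to l + 1.\<close>

lemma S_tree_eq:
  "verts (S_tree l) = leg_vertex 0 ` {..2 * l} \<union> (\<lambda>i. Some (i, 1)) ` {1..l + 1}"
  "edges (S_tree l) = (\<lambda>j. {leg_vertex 0 j, leg_vertex 0 (Suc j)}) ` {..<2 * l} \<union> (\<lambda>i. {None, Some (i, 1)}) ` {1..l + 1}"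
proof -
  let ?ks = "2 * l # replicate (l + 1) 1"
  have len: "length ?ks = l + 2"
    by simp
  have nth: "?ks ! i = (if i = 0 then 2 * l else 1)" if "i < l + 2" for i
    using that by (cases i) (simp_all del: replicate_Suc)
  \<comment> \<open>The lookup \<open>nth\<close> is available for valid indices, so it is rewritten
    under the assumption \<open>i < l + 2\<close> that \<open>conj_cong\<close> provides.\<close>
  have "(i < length ?ks \<and> j \<le> ?ks ! i) \<longleftrightarrow> (i < l + 2 \<and> j \<le> (if i = 0 then 2 * l else 1))"
    "(i < length ?ks \<and> j < ?ks ! i) \<longleftrightarrow> (i < l + 2 \<and> j < (if i = 0 then 2 * l else 1))" for i j
    by (intro conj_cong; simp only: len nth)+
  moreover have "(i < l + 2 \<and> j \<le> (if i = 0 then 2 * l else 1)) \<longleftrightarrow> (i = 0 \<and> j \<le> 2 * l) \<or> (i \<in> {1..l + 1} \<and> (j = 0 \<or> j = 1))"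
    "(i < l + 2 \<and> j < (if i = 0 then 2 * l else 1)) \<longleftrightarrow> (i = 0 \<and> j < 2 * l) \<or> (i \<in> {1..l + 1} \<and> j = 0)" for i j
    by auto
  ultimately have ks: "(i < length ?ks \<and> j \<le> ?ks ! i) \<longleftrightarrow> (i = 0 \<and> j \<le> 2 * l) \<or> (i \<in> {1..l + 1} \<and> (j = 0 \<or> j = 1))"
    and ks': "(i < length ?ks \<and> j < ?ks ! i) \<longleftrightarrow> (i = 0 \<and> j < 2 * l) \<or> (i \<in> {1..l + 1} \<and> j = 0)" for i j
    by presburger+
  have leg: "leg_vertex i 0 = leg_vertex 0 0" "leg_vertex i 0 = None" "leg_vertex i (Suc 0) = Some (i, 1)" for i
    by (simp_all add: leg_vertex_def)
  have "verts (S_tree l) = {None} \<union> {leg_vertex i j | i j. (i = 0 \<and> j \<le> 2 * l) \<or> (i \<in> {1..l + 1} \<and> (j = 0 \<or> j = 1))}"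
    unfolding S_tree_def spider_def fst_conv ks ..
  also have "\<dots> = leg_vertex 0 ` {..2 * l} \<union> (\<lambda>i. Some (i, 1)) ` {1..l + 1}"
  proof (intro equalityI subsetI)
    fix x assume "x \<in> {None} \<union> {leg_vertex i j | i j. (i = 0 \<and> j \<le> 2 * l) \<or> (i \<in> {1..l + 1} \<and> (j = 0 \<or> j = 1))}"
    then consider "x = leg_vertex 0 0" | j where "x = leg_vertex 0 j" "j \<le> 2 * l" | i where "x = Some (i, 1)" "i \<in> {1..l + 1}"
      using leg by auto
    then show "x \<in> leg_vertex 0 ` {..2 * l} \<union> (\<lambda>i. Some (i, 1)) ` {1..l + 1}"
      by cases auto
  next
    fix x assume "x \<in> leg_vertex 0 ` {..2 * l} \<union> (\<lambda>i. Some (i, 1)) ` {1..l + 1}"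
    then consider j where "x = leg_vertex 0 j" "j \<le> 2 * l" | i where "x = leg_vertex i 1" "i \<in> {1..l + 1}"
      using leg(3) by auto
    then show "x \<in> {None} \<union> {leg_vertex i j | i j. (i = 0 \<and> j \<le> 2 * l) \<or> (i \<in> {1..l + 1} \<and> (j = 0 \<or> j = 1))}"
      by cases blast+
  qed
  finally show "verts (S_tree l) = leg_vertex 0 ` {..2 * l} \<union> (\<lambda>i. Some (i, 1)) ` {1..l + 1}" .
  have "edges (S_tree l) = {{leg_vertex i j, leg_vertex i (Suc j)} | i j. (i = 0 \<and> j < 2 * l) \<or> (i \<in> {1..l + 1} \<and> j = 0)}"
    unfolding S_tree_def spider_def snd_conv ks' ..
  also have "\<dots> = (\<lambda>j. {leg_vertex 0 j, leg_vertex 0 (Suc j)}) ` {..<2 * l} \<union> (\<lambda>i. {leg_vertex i 0, leg_vertex i (Suc 0)}) ` {1..l + 1}"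
    by blast
  finally show "edges (S_tree l) = (\<lambda>j. {leg_vertex 0 j, leg_vertex 0 (Suc j)}) ` {..<2 * l} \<union> (\<lambda>i. {None, Some (i, 1)}) ` {1..l + 1}"
    unfolding leg(2,3) .
qed

lemma simple_S_tree: "simple_graph (S_tree l)"
proof -
  have "None = leg_vertex 0 0"
    by (simp add: leg_vertex_def)
  then have "None \<in> verts (S_tree l)"
    unfolding S_tree_eq by blast
  then have "e \<subseteq> verts (S_tree l) \<and> card e = 2" if "e \<in> edges (S_tree l)" for e
    using that unfolding S_tree_eq by (auto simp: leg_vertex_def)
  moreover have "finite (verts (S_tree l))"
    unfolding S_tree_eq by simp
  ultimately show ?thesis
    by (simp add: simple_graph_def)
qed

lemma edges_S_tree_nonempty: "edges (S_tree l) \<noteq> {}"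
  unfolding S_tree_eq by auto

lemma path_colour:
  assumes "two_coloured G A" "\<And>i. i < n \<Longrightarrow> {p i, p (Suc i)} \<in> edges G" "i \<le> n"
  shows "(p i \<in> A) = ((p 0 \<in> A) = even i)"
  using assms(3)
proof (induction i)
  case (Suc i)
  then have "(p i \<in> A) \<noteq> (p (Suc i) \<in> A)"
    using assms(1) assms(2)[of i] unfolding two_coloured_def by simp
  then show ?case
    using Suc by auto
qed simp

text \<open>Counts the positions on a path at odd distance from its end \<open>n\<close>, the only
  ones where neighbours of the end can sit in a bipartite graph.\<close>

lemma card_odd_le: "card {i. i \<le> n \<and> odd (n - i :: nat)} \<le> Suc n div 2"
proof -
  have "{i. i \<le> n \<and> odd (n - i)} \<subseteq> (\<lambda>q. n - Suc (2 * q)) ` {..<Suc n div 2}"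
  proof
    fix i assume i: "i \<in> {i. i \<le> n \<and> odd (n - i)}"
    then obtain q where "n - i = 2 * q + 1"
      using oddE[of "n - i"] by blast
    then show "i \<in> (\<lambda>q. n - Suc (2 * q)) ` {..<Suc n div 2}"
      using i by (intro image_eqI[of _ _ q]) auto
  qed
  from surj_card_le[OF _ this] show ?thesis
    by simp
qed

text \<open>When the path ends at position \<open>n\<close>, at most \<open>(n + 1) div 2\<close> of
  its vertices are in the class opposite to the end. For n < 2 k this is at most \<open>k\<close>,
  so an end of degree above \<open>k\<close> has a neighbour off the path.\<close>

lemma greedy_path:
  assumes G: "simple_graph G" "two_coloured G A" and c: "c \<in> verts G"
    and deg: "\<And>v. v \<in> verts G \<Longrightarrow> k < deg G v" and "n \<le> 2 * k"
  shows "\<exists>p. p 0 = c \<and> inj_on p {..n} \<and> (\<forall>i<n. {p i, p (Suc i)} \<in> edges G)"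
  using \<open>n \<le> 2 * k\<close>
proof (induction n)
  case 0
  show ?case by (intro exI[of _ "\<lambda>_. c"]) simp
next
  case (Suc n)
  then obtain p where p: "p 0 = c" "inj_on p {..n}" "\<And>i. i < n \<Longrightarrow> {p i, p (Suc i)} \<in> edges G"
    by auto
  have "p n \<in> verts G"
    using c p(1) edge_verts(2)[OF G(1) p(3), of "n - 1"] by (cases n) auto
  then have "k < deg G (p n)"
    by (rule deg)
  have "nbrs G (p n) \<inter> p ` {..n} \<subseteq> p ` {i. i \<le> n \<and> odd (n - i)}"
  proof
    fix x assume "x \<in> nbrs G (p n) \<inter> p ` {..n}"
    then obtain i where i: "i \<le> n" "x = p i" "p i \<in> nbrs G (p n)"
      by auto
    then have "even i \<noteq> even n"
      using nbrs_two_coloured[OF G(2) i(3)] path_colour[of G A n p i, OF G(2) p(3) i(1)]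
        path_colour[of G A n p n, OF G(2) p(3) order_refl] by metis
    then show "x \<in> p ` {i. i \<le> n \<and> odd (n - i)}"
      using i by auto
  qed
  then have "card (nbrs G (p n) \<inter> p ` {..n}) \<le> card {i. i \<le> n \<and> odd (n - i)}"
    by (intro surj_card_le) simp_all
  also have "\<dots> \<le> k"
    using card_odd_le[of n] Suc.prems by linarith
  finally have "\<not> nbrs G (p n) \<subseteq> p ` {..n}"
    using \<open>k < deg G (p n)\<close> by (auto simp: Int_absorb2)
  then obtain x where x: "{p n, x} \<in> edges G" "x \<notin> p ` {..n}"
    by (auto simp: nbrs_def)
  let ?p = "p(Suc n := x)"
  have "inj_on ?p {..n} \<and> ?p (Suc n) \<notin> ?p ` {..n}"
    using p(2) x(2) by (auto simp: inj_on_def)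
  then have "inj_on ?p {..Suc n}"
    unfolding atMost_Suc by (simp add: inj_on_insert)
  moreover have "{?p i, ?p (Suc i)} \<in> edges G" if "i < Suc n" for i
    using that p(3) x(1) by (cases "i = n") auto
  moreover have "?p 0 = c"
    using p(1) by simp
  ultimately show ?case
    by blast
qed

text \<open>Grow the long leg from \<open>c\<close> first. It meets the class opposite to
  \<open>c\<close> in at most \<open>l\<close> vertices, so more than \<open>2 * l\<close>
  neighbours of \<open>c\<close> leave \<open>l + 1\<close> for the pendant edges.\<close>

lemma S_tree_embeds:
  assumes G: "simple_graph G" "two_coloured G A" and c: "c \<in> verts G" "2 * l < deg G c"
    and deg: "\<And>v. v \<in> verts G \<Longrightarrow> l < deg G v"
  shows "\<exists>f. embeds f (S_tree l) G"
proof -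
  obtain p where p: "p 0 = c" "inj_on p {..2 * l}" "\<And>i. i < 2 * l \<Longrightarrow> {p i, p (Suc i)} \<in> edges G"
    using greedy_path[OF G c(1) deg, of "2 * l"] by auto
  \<comment> \<open>For \<open>i \<le> 2 * l\<close> this is the same as \<open>odd i\<close>; the
    form matches \<open>card_odd_le\<close>.\<close>
  let ?odd = "p ` {i. i \<le> 2 * l \<and> odd (2 * l - i)}"
  have "card ?odd \<le> card {i. i \<le> 2 * l \<and> odd (2 * l - i)}"
    by (intro card_image_le) simp
  then have "card ?odd \<le> l"
    using card_odd_le[of "2 * l"] by linarith
  then have selectable: "l + 1 \<le> card (nbrs G c - ?odd)"
    using diff_card_le_card_Diff[of ?odd "nbrs G c"] c(2) by simp
  obtain g where g: "inj_on g {1..l + 1}" "\<And>j. \<lbrakk>0 < j; j \<le> l + 1\<rbrakk> \<Longrightarrow> g j \<in> nbrs G c - ?odd"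
    using obtain_selection[OF finite_Diff[OF finite_nbrs[OF G(1)]] selectable] by blast
  define f where "f = (\<lambda>x. case x of None \<Rightarrow> c | Some (i, j) \<Rightarrow> if i = 0 then p j else g i)"
  have f_path: "f (leg_vertex 0 j) = p j" for j
    using p(1) by (simp add: f_def leg_vertex_def)
  have f_leaf: "f (Some (i, 1)) = g i" if "i \<in> {1..l + 1}" for i
    using that by (simp add: f_def)
  have g_edge: "{c, g i} \<in> edges G" if "i \<in> {1..l + 1}" for i
    using g(2)[of i] that by (auto simp: nbrs_def)
  have p_verts: "p i \<in> verts G" if "i \<le> 2 * l" for i
    using c(1) p(1) edge_verts(2)[OF G(1) p(3), of "i - 1"] that by (cases i) auto
  have disjoint: "p i \<noteq> g j" if "i \<le> 2 * l" "j \<in> {1..l + 1}" for i j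
  proof
    assume eq: "p i = g j"
    then have "(p i \<in> A) \<noteq> (c \<in> A)"
      using nbrs_two_coloured[OF G(2), of "g j" c] g_edge[OF that(2)] by (simp add: nbrs_def)
    then have "odd i"
      using path_colour[of G A "2 * l" p, OF G(2) p(3) that(1)] p(1) by auto
    then have "p i \<in> ?odd"
      using that(1) by auto
    then show False
      using g(2)[of j] that(2) eq by auto
  qed
  have "embeds f (S_tree l) G"
    unfolding embeds_def S_tree_eq
  proof (intro conjI ballI inj_on_Un_disjoint)
    show "inj_on f (leg_vertex 0 ` {..2 * l})"
      using p(2) f_path by (auto simp: inj_on_def)
    show "inj_on f ((\<lambda>i. Some (i, 1)) ` {1..l + 1})"
      using g(1) f_leaf by (auto simp: inj_on_def)
    show "f ` leg_vertex 0 ` {..2 * l} \<inter> f ` (\<lambda>i. Some (i, 1)) ` {1..l + 1} = {}"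
      using disjoint f_path f_leaf by fastforce
    show "f ` (leg_vertex 0 ` {..2 * l} \<union> (\<lambda>i. Some (i, 1)) ` {1..l + 1}) \<subseteq> verts G"
      using p_verts edge_verts(2)[OF G(1) g_edge] f_path f_leaf by fastforce
    fix e assume "e \<in> (\<lambda>j. {leg_vertex 0 j, leg_vertex 0 (Suc j)}) ` {..<2 * l} \<union> (\<lambda>i. {None, Some (i, 1)}) ` {1..l + 1}"
    then show "f ` e \<in> edges G"
      using p(3) f_path f_leaf g_edge by (auto simp: f_def)
  qed
  then show ?thesis by blast
qed

lemma S_tree_free_card_edges_le:
  assumes G: "simple_graph G" "two_coloured G A" and free: "free_of (S_tree l) G"
  shows "card (edges G) \<le> l * card (verts G)"
proof (rule ccontr)
  assume "\<not> ?thesis"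
  then obtain H where H: "subgraph H G" "l * card (verts H) < card (edges H)"
    and min_deg: "\<And>v. v \<in> verts H \<Longrightarrow> l < deg H v"
    using dense_subgraph[OF G(1)] by (meson not_le)
  have simple: "simple_graph H"
    using H(1) by (simp add: subgraph_def)
  obtain c where c: "c \<in> verts H" "2 * l < deg H c"
    using exists_high_degree[OF simple H(2)] by blast
  have "\<exists>f. embeds f (S_tree l) H"
    by (rule S_tree_embeds[OF simple two_coloured_subgraph[OF H(1) G(2)] c min_deg])
  then show False
    using free_of_subgraph[OF H(1) free] free_of_iff[OF simple_S_tree] by blast
qed

subsection \<open>Discharging for double stars\<close>

text \<open>Every edge hands out a total charge of 2: an edge with an end of degree more than \<open>t\<close> gives
  all of it to its other end, any other edge gives 1 to each end.\<close>

definition charge :: "'v graph \<Rightarrow> nat \<Rightarrow> 'v \<Rightarrow> nat" where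
  "charge G t v = (\<Sum>u\<in>nbrs G v. if t < deg G v then 0 else if t < deg G u then 2 else 1)"

text \<open>The degree form of being D_{s,t}-free. As \<open>sparse\<close> applies to both orders
  of an edge, every neighbour of a vertex of degree above \<open>t\<close> has degree at most
  \<open>s\<close>.\<close>

locale star_sparse =
  fixes G :: "'v graph" and s t :: nat
  assumes simple: "simple_graph G" and st: "s \<le> t"
    and sparse: "{u, v} \<in> edges G \<Longrightarrow> deg G u \<le> s \<or> deg G v \<le> t"
begin

lemma finite_verts: "finite (verts G)"
  using simple by (simp add: simple_graph_def)

text \<open>The rule would hand out nothing only if both ends had degree above \<open>t\<close>,
  which \<open>sparse\<close> and \<open>s \<le> t\<close> forbid.\<close>

lemma edges_le_charge: "2 * card (edges G) \<le> (\<Sum>v\<in>verts G. charge G t v)"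
  unfolding charge_def
proof (rule discharging[OF simple])
  fix u v assume "{u, v} \<in> edges G"
  then have "deg G u \<le> t \<or> deg G v \<le> t"
    using sparse st by fastforce
  then show "2 \<le> (if t < deg G u then 0 else if t < deg G v then 2 else 1) +
      (if t < deg G v then 0 else if t < deg G u then 2 else (1 :: nat))"
    by auto
qed

lemma charge_high: "t < deg G v \<Longrightarrow> charge G t v = 0"
  by (simp add: charge_def)

lemma charge_next_to_high:
  assumes "u \<in> nbrs G v" "t < deg G u"
  shows "deg G v \<le> s" "charge G t v \<le> 2 * s"
proof -
  show "deg G v \<le> s"
    using sparse[of v u] assms by (auto simp: nbrs_def)
  moreover have "charge G t v \<le> (\<Sum>u\<in>nbrs G v. 2)"
    unfolding charge_def by (intro sum_mono) simp
  ultimately show "charge G t v \<le> 2 * s"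
    by simp
qed

lemma charge_le_t:
  assumes "\<And>u. u \<in> nbrs G v \<Longrightarrow> deg G u \<le> t"
  shows "charge G t v \<le> t"
proof (cases "t < deg G v")
  case False
  have "charge G t v \<le> (\<Sum>u\<in>nbrs G v. 1)"
    unfolding charge_def using assms by (intro sum_mono) (simp add: leD)
  then show ?thesis
    using False by simp
qed (simp add: charge_high)

text \<open>Either some neighbour has degree above \<open>t\<close>, and then at most
  \<open>s\<close> edges give at most 2 each, or none has, and at most \<open>t\<close> edges give 1
  each.\<close>

lemma charge_le: "charge G t v \<le> max t (2 * s)"
  using charge_next_to_high(2)[of _ v] charge_le_t[of v] by (meson le_max_iff_disj not_less)

lemma card_edges_le:
  assumes "2 * s \<le> t"
  shows "2 * card (edges G) \<le> t * card (verts G)"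
proof -
  have "(\<Sum>v\<in>verts G. charge G t v) \<le> (\<Sum>v\<in>verts G. t)"
    using charge_le assms by (intro sum_mono) (simp add: max_absorb1)
  then show ?thesis
    using edges_le_charge by (simp add: mult.commute)
qed

text \<open>Since \<open>t < 2 * s\<close>, a charge of \<open>2 * s\<close> needs a neighbour of
  degree above \<open>t\<close>. The degree is then at most \<open>s\<close>, so there must be
  exactly \<open>s\<close> edges, each giving 2.\<close>

lemma charge_full:
  assumes "t < 2 * s" "2 * s \<le> charge G t v"
  shows "deg G v = s" "u \<in> nbrs G v \<Longrightarrow> t < deg G u"
proof -
  obtain w where "w \<in> nbrs G v" "t < deg G w"
    using charge_le_t[of v] assms by (meson leD le_trans not_le)
  then have deg: "deg G v \<le> s"
    by (rule charge_next_to_high)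
  have "charge G t v \<le> (\<Sum>u\<in>nbrs G v. 2)"
    unfolding charge_def by (intro sum_mono) simp
  then show eq: "deg G v = s"
    using deg assms by simp
  assume u: "u \<in> nbrs G v"
  show "t < deg G u"
  proof (rule ccontr)
    assume low: "\<not> t < deg G u"
    have "charge G t v < (\<Sum>u\<in>nbrs G v. 2)"
      unfolding charge_def
      by (rule sum_strict_mono_ex1[OF finite_nbrs[OF simple]]) (use u low in auto)
    then show False
      using assms eq by simp
  qed
qed

lemma charge_le_2s: "t < 2 * s \<Longrightarrow> charge G t v \<le> 2 * s"
  using charge_le[of v] by simp

end

section \<open>Counting high-degree vertices in both parts, and the equality case\<close>

locale bipartite_star_sparse = star_sparse +
  fixes A B :: "'a set"
  assumes bip: "bipartition G A B"
begin

abbreviation high :: "'a set" where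
  "high \<equiv> {v \<in> verts G. t < deg G v}"

lemma parts: "A \<union> B = verts G" "A \<inter> B = {}" "finite A" "finite B" "card (verts G) = card A + card B"
  using bip bipartition_finite[OF simple bip] by (auto simp: bipartition_def)

text \<open>Lets an argument about high vertices in \<open>B\<close> be reused for
  \<open>A\<close>.\<close>

lemma flipped: "bipartite_star_sparse G s t B A"
proof
  show "bipartition G B A"
    using bip unfolding bipartition_def by (metis Int_commute Un_commute insert_commute)
qed

text \<open>A vertex of \<open>A\<close> with full charge has \<open>s\<close> high neighbours, all
  in \<open>B\<close>. If \<open>B\<close> has fewer, every vertex of \<open>A\<close> loses 1 of
  its \<open>2 * s\<close>, and \<open>card A\<close> exceeds the 4 s^2 by which twice the target
  falls short of the total of full charges.\<close>

lemma card_edges_less_if_few_high: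
  assumes "t < 2 * s" "card (high \<inter> B) < s" "4 * s ^ 2 < card A"
  shows "card (edges G) < s * (card A + card B - 2 * s)"
proof -
  have not_full: "charge G t v \<le> 2 * s - 1" if v: "v \<in> A" for v
  proof (rule ccontr)
    assume "\<not> ?thesis"
    then have full: "2 * s \<le> charge G t v"
      by simp
    have "nbrs G v \<subseteq> high \<inter> B"
    proof
      fix u assume u: "u \<in> nbrs G v"
      then have "u \<in> verts G" "u \<notin> A"
        using nbrs_subset[OF simple] nbrs_two_coloured[OF bipartite_two_coloured[OF bip] u] v by auto
      then show "u \<in> high \<inter> B"
        using parts(1) charge_full(2)[OF assms(1) full u] by auto
    qed
    then have "s \<le> card (high \<inter> B)"
      using charge_full(1)[OF assms(1) full] finite_verts card_mono[of "high \<inter> B" "nbrs G v"] by simp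
    then show False
      using assms(2) by simp
  qed
  have "2 * card (edges G) \<le> (\<Sum>v\<in>A. charge G t v) + (\<Sum>v\<in>B. charge G t v)"
    using edges_le_charge sum.union_disjoint[OF parts(3,4,2)] unfolding parts(1) by metis
  also have "\<dots> \<le> (\<Sum>v\<in>A. 2 * s - 1) + (\<Sum>v\<in>B. 2 * s)"
    using not_full charge_le_2s[OF assms(1)] by (intro add_mono sum_mono) auto
  finally have "2 * card (edges G) \<le> card A * (2 * s - 1) + card B * (2 * s)"
    by simp
  \<comment> \<open>The comparison is done over the integers, where the differences are not
    truncated.\<close>
  then have "int (2 * card (edges G)) \<le> int (card A * (2 * s - 1) + card B * (2 * s))"
    by (rule zle_int[THEN iffD2])
  then have "2 * int (card (edges G)) \<le> int (card A) * int (2 * s - 1) + int (card B) * (2 * int s)"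
    by (simp only: of_nat_mult of_nat_add of_nat_numeral)
  also have "int (2 * s - 1) = 2 * int s - 1"
    using assms(1) by (simp add: of_nat_diff)
  also have "int (card A) * (2 * int s - 1) + int (card B) * (2 * int s)
      = 2 * (int s * (int (card A) + int (card B) - 2 * int s)) + 4 * int s ^ 2 - int (card A)"
    by (simp add: algebra_simps power2_eq_square)
  also have "\<dots> < 2 * (int s * (int (card A) + int (card B) - 2 * int s))"
    using of_nat_less_iff[where 'a = int, THEN iffD2, OF assms(3)] by simp
  finally have less: "int (card (edges G)) < int s * (int (card A) + int (card B) - 2 * int s)"
    by simp
  \<comment> \<open>Needed to see that \<open>card A + card B - 2 * s\<close> is a genuine
    difference on \<open>nat\<close>.\<close>
  have "s \<le> s ^ 2"
    by (simp add: power2_eq_square)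
  then have "2 * s \<le> card A + card B"
    using assms(3) by linarith
  then have "int (card A) + int (card B) - 2 * int s = int (card A + card B - 2 * s)"
    by (simp add: of_nat_diff)
  from less[unfolded this] show ?thesis
    by (simp only: of_nat_less_iff flip: of_nat_mult)
qed

lemma card_high: "card (high \<inter> A) + card (high \<inter> B) = card high" "card high \<le> card A + card B"
proof -
  have "high = (high \<inter> A) \<union> (high \<inter> B)"
    using parts(1) by blast
  moreover have "card ((high \<inter> A) \<union> (high \<inter> B)) = card (high \<inter> A) + card (high \<inter> B)"
    using parts by (intro card_Un_disjoint) auto
  ultimately show "card (high \<inter> A) + card (high \<inter> B) = card high"
    by simp
  show "card high \<le> card A + card B"
    unfolding parts(5)[symmetric] using finite_verts by (intro card_mono) auto
qed

lemma double_edges_le: "2 * card (edges G) \<le> (\<Sum>v\<in>verts G - high. charge G t v)"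
proof -
  have "(\<Sum>v\<in>verts G. charge G t v) = (\<Sum>v\<in>verts G - high. charge G t v)"
    using finite_verts charge_high by (intro sum.mono_neutral_right) auto
  then show ?thesis
    using edges_le_charge by simp
qed

lemma card_low: "card (verts G - high) = card A + card B - card high"
  using finite_verts by (subst card_Diff_subset) (auto simp: parts(5))

lemma card_edges_le_of_high:
  assumes "t < 2 * s"
  shows "card (edges G) \<le> s * (card A + card B - card high)"
proof -
  have "(\<Sum>v\<in>verts G - high. charge G t v) \<le> (\<Sum>v\<in>verts G - high. 2 * s)"
    using charge_le_2s[OF assms] by (rule sum_mono)
  then show ?thesis
    using double_edges_le card_low by (simp add: mult.commute)
qed

lemma few_high_cases:
  assumes "t < 2 * s" "4 * s ^ 2 < card A" "4 * s ^ 2 < card B"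
  shows "card (edges G) < s * (card A + card B - 2 * s) \<or> s \<le> card (high \<inter> A) \<and> s \<le> card (high \<inter> B)"
proof -
  interpret flip: bipartite_star_sparse G s t B A
    by (rule flipped)
  have "card (edges G) < s * (card A + card B - 2 * s)" if "card (high \<inter> A) < s"
    using flip.card_edges_less_if_few_high[OF assms(1) that assms(3)] by (simp only: add.commute)
  then show ?thesis
    using card_edges_less_if_few_high[OF assms(1) _ assms(2)] not_less by blast
qed

text \<open>With \<open>s\<close> high vertices in each part, at least \<open>2 * s\<close> vertices
  have charge 0 and each other vertex has at most \<open>2 * s\<close>.\<close>

lemma card_edges_le_small:
  assumes "t < 2 * s" "4 * s ^ 2 < card A" "4 * s ^ 2 < card B"
  shows "card (edges G) \<le> s * (card A + card B - 2 * s)"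
  using few_high_cases[OF assms]
proof
  assume "s \<le> card (high \<inter> A) \<and> s \<le> card (high \<inter> B)"
  then have "card A + card B - card high \<le> card A + card B - 2 * s"
    using card_high(1) by linarith
  then show ?thesis
    using le_trans[OF card_edges_le_of_high[OF assms(1)] mult_le_mono2] by blast
qed simp

text \<open>Equality leaves exactly \<open>2 * s\<close> high vertices and a full charge at every
  other vertex. A low vertex then has \<open>s\<close> neighbours, all high and in the other part,
  hence all the high vertices there; two high vertices are never adjacent.\<close>

lemma extremal_structure:
  assumes "t < 2 * s" "4 * s ^ 2 < card A" "4 * s ^ 2 < card B"
    and extremal: "card (edges G) = s * (card A + card B - 2 * s)"
  shows "card (high \<inter> A) = s" "card (high \<inter> B) = s"
    and "edges G = {{x, y} | x y. x \<in> A - high \<and> y \<in> high \<inter> B} \<union> {{x, y} | x y. x \<in> B - high \<and> y \<in> high \<inter> A}"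
proof -
  have many: "s \<le> card (high \<inter> A)" "s \<le> card (high \<inter> B)"
    using few_high_cases[OF assms(1-3)] extremal by auto
  have "s > 0"
    using assms(1) by simp
  then have "s \<le> s ^ 2" "s > 0"
    by (simp_all add: power2_eq_square)
  \<comment> \<open>Makes the truncated differences comparable, so that the edge bound yields
    \<open>card high \<le> 2 * s\<close>.\<close>
  then have n: "2 * s < card A + card B"
    using assms(2) by linarith
  have "card A + card B - 2 * s \<le> card A + card B - card high"
    using card_edges_le_of_high[OF assms(1)] extremal \<open>s > 0\<close> by simp
  then have "card high = 2 * s"
    using card_high many n by linarith
  then show card_A: "card (high \<inter> A) = s" and card_B: "card (high \<inter> B) = s"
    using card_high(1) many by linarith+
  \<comment> \<open>A single deficient low vertex would push the total charge below twice the number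
    of edges.\<close>
  have full: "2 * s \<le> charge G t v" if v: "v \<in> verts G - high" for v
  proof (rule ccontr)
    assume "\<not> ?thesis"
    then have "(\<Sum>v\<in>verts G - high. charge G t v) < (\<Sum>v\<in>verts G - high. 2 * s)"
      using v finite_verts charge_le_2s[OF assms(1)]
      by (intro sum_strict_mono_ex1) (auto simp: not_le)
    also have "\<dots> = 2 * card (edges G)"
      using card_low \<open>card high = 2 * s\<close> extremal by simp
    finally show False
      using double_edges_le by simp
  qed
  \<comment> \<open>Stated for \<open>X\<close> and \<open>Y\<close> so that both parts are covered
    at once; inclusion together with the common size \<open>s\<close> gives equality.\<close>
  have nbrs_in: "nbrs G v = high \<inter> Y"
    if v: "v \<in> X - high" and XY: "(X = A \<and> Y = B) \<or> (X = B \<and> Y = A)" for v X Y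
  proof (rule card_subset_eq)
    have v': "v \<in> verts G - high"
      using v XY parts(1) by auto
    show "nbrs G v \<subseteq> high \<inter> Y"
    proof
      fix u assume u: "u \<in> nbrs G v"
      then have "u \<in> verts G" "(u \<in> A) \<noteq> (v \<in> A)"
        using nbrs_subset[OF simple] nbrs_two_coloured[OF bipartite_two_coloured[OF bip] u] by auto
      then show "u \<in> high \<inter> Y"
        using parts(1,2) XY v charge_full(2)[OF assms(1) full[OF v'] u] by auto
    qed
    show "card (nbrs G v) = card (high \<inter> Y)"
      using charge_full(1)[OF assms(1) full[OF v']] card_A card_B XY by auto
  qed (use parts XY in auto)
  show "edges G = {{x, y} | x y. x \<in> A - high \<and> y \<in> high \<inter> B} \<union> {{x, y} | x y. x \<in> B - high \<and> y \<in> high \<inter> A}"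
  proof (intro equalityI subsetI)
    fix e assume e: "e \<in> edges G"
    then obtain x y where xy: "x \<in> A" "y \<in> B" "e = {x, y}"
      using bip unfolding bipartition_def by metis
    then have nbr: "y \<in> nbrs G x" "x \<in> nbrs G y"
      using e by (auto simp: nbrs_def insert_commute)
    have "x \<notin> high \<or> y \<notin> high"
      using sparse[of x y] e xy st by auto
    then show "e \<in> {{x, y} | x y. x \<in> A - high \<and> y \<in> high \<inter> B} \<union> {{x, y} | x y. x \<in> B - high \<and> y \<in> high \<inter> A}"
    proof
      assume "x \<notin> high"
      then have "x \<in> A - high"
        using xy(1) by blast
      moreover from this have "y \<in> high \<inter> B"
        using nbrs_in[of x A B] nbr(1) by blast
      ultimately show ?thesis
        using xy(3) by blast
    next
      assume "y \<notin> high"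
      then have "y \<in> B - high"
        using xy(2) by blast
      moreover from this have "x \<in> high \<inter> A"
        using nbrs_in[of y B A] nbr(2) by blast
      moreover have "e = {y, x}"
        using xy(3) by blast
      ultimately show ?thesis
        by blast
    qed
  next
    fix e assume "e \<in> {{x, y} | x y. x \<in> A - high \<and> y \<in> high \<inter> B} \<union> {{x, y} | x y. x \<in> B - high \<and> y \<in> high \<inter> A}"
    then obtain x y where "e = {x, y}" "y \<in> nbrs G x"
      using nbrs_in[of _ A B] nbrs_in[of _ B A] by blast
    then show "e \<in> edges G"
      by (simp add: nbrs_def)
  qed
qed

end

subsection \<open>Disjoint copies of balanced complete bipartite graphs\<close>

text \<open>For \<open>k\<close> positive and dividing \<open>n\<close>, this is the union of
  \<open>n div k\<close> disjoint copies of K_{k,k}: the first coordinate is the side and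
  \<open>i div k\<close> the number of the copy.\<close>

definition blocks :: "nat \<Rightarrow> nat \<Rightarrow> (nat \<times> nat) graph" where
  "blocks k n = ({0, 1} \<times> {..<n},
     (\<lambda>(i, j). {(0, i), (1, j)}) ` {(i, j). i < n \<and> j < n \<and> i div k = j div k})"

lemma blocks_edgeE:
  assumes "{u, v} \<in> edges (blocks k n)"
  shows "fst u \<noteq> fst v" "fst u \<le> 1" "fst v \<le> 1" "snd u div k = snd v div k"
proof -
  obtain i j where "{u, v} = {(0, i), (1, j)}" "i div k = j div k"
    using assms unfolding blocks_def by auto
  then have "u = (0, i) \<and> v = (1, j) \<or> u = (1, j) \<and> v = (0, i)"
    by (simp add: doubleton_eq_iff)
  with \<open>i div k = j div k\<close> show "fst u \<noteq> fst v" "fst u \<le> 1" "fst v \<le> 1" "snd u div k = snd v div k"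
    by auto
qed

lemma bipartite_blocks: "bipartite_graph n n (blocks k n)"
proof -
  have "bipartition (blocks k n) ({0} \<times> {..<n}) ({1} \<times> {..<n})"
    by (auto simp: bipartition_def blocks_def)
  moreover have "card e = 2 \<and> e \<subseteq> verts (blocks k n)" if "e \<in> edges (blocks k n)" for e
    using that by (auto simp: blocks_def)
  then have "simple_graph (blocks k n)"
    by (auto simp: simple_graph_def blocks_def)
  ultimately show ?thesis
    unfolding bipartite_graph_def by (intro conjI exI) (auto simp: card_cartesian_product)
qed

lemma div_class:
  assumes "0 < k"
  shows "{j :: nat. j div k = q} = {q * k..<q * k + k}"
proof (intro equalityI subsetI)
  fix j assume "j \<in> {j. j div k = q}"
  then show "j \<in> {q * k..<q * k + k}"
    using div_mult_mod_eq[of j k] mod_less_divisor[OF assms, of j] by auto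
next
  fix j assume "j \<in> {q * k..<q * k + k}"
  then show "j \<in> {j. j div k = q}"
    using assms by (auto intro!: div_nat_eqI simp: mult.commute)
qed

lemma card_edges_blocks:
  assumes "k dvd n"
  shows "card (edges (blocks k n)) = k * n"
proof (cases "k = 0")
  \<comment> \<open>0 divides only 0, so there are no vertices at all.\<close>
  case True
  then show ?thesis
    using assms by (simp add: blocks_def)
next
  case False
  then have k: "0 < k" by simp
  obtain m where n: "n = k * m"
    using assms by blast
  \<comment> \<open>Divisibility keeps the last block complete, so every vertex has exactly
    \<open>k\<close> neighbours.\<close>
  have "j < n" if "i < n" "j div k = i div k" for i j
  proof -
    have "i div k < m"
      using that(1) n k by (simp add: div_less_iff_less_mult mult.commute)
    then show ?thesis
      using that(2) n k by (metis div_less_iff_less_mult mult.commute)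
  qed
  then have eq: "{(i, j). i < n \<and> j < n \<and> i div k = j div k} = Sigma {..<n} (\<lambda>i. {j. j div k = i div k})"
    by auto
  have "inj_on (\<lambda>(i, j). {(0 :: nat, i), (1 :: nat, j)}) X" for X :: "(nat \<times> nat) set"
    by (rule inj_onI) (clarsimp simp: doubleton_eq_iff)
  then have "card (edges (blocks k n)) = card (Sigma {..<n} (\<lambda>i. {j. j div k = i div k}))"
    unfolding blocks_def eq snd_conv by (rule card_image)
  also have "\<dots> = k * n"
    using k by (simp add: div_class)
  finally show ?thesis .
qed

text \<open>Applied both to a neighbourhood and to one colour class of an embedded tree: each stays
  on one side of one block.\<close>

lemma card_same_block:
  assumes "0 < k" "\<And>v. v \<in> V \<Longrightarrow> fst v = c \<and> snd v div k = q"
  shows "finite V" "card V \<le> k"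
proof -
  have "V \<subseteq> {c} \<times> {j. j div k = q}"
    using assms(2) by (auto simp: mem_Times_iff)
  then have sub: "V \<subseteq> {c} \<times> {q * k..<q * k + k}"
    unfolding div_class[OF assms(1)] .
  then show "finite V"
    by (rule finite_subset) simp
  show "card V \<le> k"
    using card_mono[OF _ sub] by (simp add: card_cartesian_product)
qed

text \<open>All degrees are at most \<open>t\<close>, while one centre of the double star has degree
  t + 1.\<close>

lemma double_star_free_blocks:
  assumes "0 < t"
  shows "free_of (double_star s t) (blocks t n)"
proof (rule double_star_freeI)
  show "simple_graph (blocks t n)"
    using bipartite_blocks by (simp add: bipartite_graph_def)
  fix u v
  have "fst w = (if fst v = 0 then 1 else 0) \<and> snd w div t = snd v div t" if "w \<in> nbrs (blocks t n) v" for w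
    using blocks_edgeE[of v w t n] that by (auto simp: nbrs_def)
  then show "deg (blocks t n) u \<le> s \<or> deg (blocks t n) v \<le> t"
    using card_same_block(2)[OF assms, of "nbrs (blocks t n) v"] by blast
qed

text \<open>The spider is connected, so a copy stays in one block, and its colour class avoiding the
  common vertex would have to fit into a side of size \<open>2 * l\<close>.\<close>

lemma S_tree_free_blocks:
  assumes "0 < l"
  shows "free_of (S_tree l) (blocks (2 * l) n)"
  unfolding free_of_iff[OF simple_S_tree]
proof
  let ?G = "blocks (2 * l) n"
  assume "\<exists>f. embeds f (S_tree l) ?G"
  then obtain f where f: "embeds f (S_tree l) ?G"
    by blast
  have path: "{f (leg_vertex 0 j), f (leg_vertex 0 (Suc j))} \<in> edges ?G" if "j < 2 * l" for j
    using f by (rule embeds_edge) (use that in \<open>simp add: S_tree_eq\<close>)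
  have leaf: "{f None, f (Some (i, 1))} \<in> edges ?G" if "i \<in> {1..l + 1}" for i
    using f by (rule embeds_edge) (use that in \<open>simp add: S_tree_eq\<close>)
  \<comment> \<open>First coordinates are 0 or 1, so this is the side opposite to the image of
    \<open>None\<close>.\<close>
  let ?opp = "1 - fst (f None)"
  let ?q = "snd (f None) div (2 * l)"
  have start: "leg_vertex 0 0 = None"
    by (simp add: leg_vertex_def)
  have opp: "fst (f None) \<le> 1"
    using blocks_edgeE(2)[OF path[of 0]] assms start by simp
  have along: "fst (f (leg_vertex 0 j)) = (if even j then fst (f None) else ?opp) \<and> snd (f (leg_vertex 0 j)) div (2 * l) = ?q"
    if "j \<le> 2 * l" for j
    using that
  proof (induction j)
    case 0
    then show ?case by (simp add: start)
  next
    case (Suc j)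
    then show ?case
      using blocks_edgeE[OF path[of j]] opp by (cases "even j") auto
  qed
  have leaves: "fst (f (Some (i, 1))) = ?opp \<and> snd (f (Some (i, 1))) div (2 * l) = ?q" if "i \<in> {1..l + 1}" for i
    using blocks_edgeE[OF leaf[OF that]] opp by auto
  \<comment> \<open>The colour class not containing \<open>None\<close>: the \<open>l\<close> odd
    positions of the long leg and the \<open>l + 1\<close> pendant leaves.\<close>
  let ?V = "(\<lambda>q. leg_vertex 0 (2 * q + 1)) ` {..<l} \<union> (\<lambda>i. Some (i, 1)) ` {1..l + 1}"
  have "card ?V = card ((\<lambda>q. leg_vertex 0 (2 * q + 1)) ` {..<l}) + card ((\<lambda>i. Some (i, 1)) ` {1..l + 1} :: (nat \<times> nat) option set)"
    by (intro card_Un_disjoint) (auto simp: leg_vertex_def)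
  also have "\<dots> = 2 * l + 1"
    by (simp add: card_image inj_on_def leg_vertex_def)
  finally have card_V: "card ?V = 2 * l + 1" .
  have "?V \<subseteq> verts (S_tree l)"
    unfolding S_tree_eq by fastforce
  then have "card (f ` ?V) = 2 * l + 1"
    using f card_V by (metis card_image embeds_def inj_on_subset)
  moreover have "fst v = ?opp \<and> snd v div (2 * l) = ?q" if "v \<in> f ` ?V" for v
    using that along leaves by auto
  then have "card (f ` ?V) \<le> 2 * l"
    using assms by (intro card_same_block(2)) auto
  ultimately show False
    by simp
qed

subsection \<open>The extremal graph for double stars\<close>

text \<open>The outer constructor selects the component; inside it \<open>Inl\<close> marks the
  \<open>s\<close> centres and \<open>Inr\<close> the remaining vertices, called leaves
  below.\<close>

abbreviation two_stars :: "nat \<Rightarrow> nat \<Rightarrow> nat \<Rightarrow> ((nat + nat) + (nat + nat)) graph" where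
  "two_stars s a b \<equiv> disjoint_union (complete_bipartite s (a - s)) (complete_bipartite s (b - s))"

lemma verts_two_stars:
  "verts (two_stars s a b) = (\<lambda>i. Inl (Inl i)) ` {..<s} \<union> (\<lambda>j. Inl (Inr j)) ` {..<a - s}
     \<union> ((\<lambda>i. Inr (Inl i)) ` {..<s} \<union> (\<lambda>j. Inr (Inr j)) ` {..<b - s})"
  unfolding disjoint_union_def complete_bipartite_def fst_conv Plus_def image_Un image_image ..

lemma edges_two_stars:
  "edges (two_stars s a b) = (\<lambda>(i, j). {Inl (Inl i), Inl (Inr j)}) ` ({..<s} \<times> {..<a - s})
     \<union> (\<lambda>(i, j). {Inr (Inl i), Inr (Inr j)}) ` ({..<s} \<times> {..<b - s})"
proof -
  have "{{Inl i, Inr j} | i j. i < m \<and> j < n} = (\<lambda>(i, j). {Inl i, Inr j}) ` ({..<m} \<times> {..<n})" for m n :: nat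
    by auto
  then show ?thesis
    unfolding disjoint_union_def complete_bipartite_def snd_conv
    by (simp add: image_image case_prod_unfold)
qed

lemma edges_two_starsE:
  assumes "e \<in> edges (two_stars s a b)"
  obtains i j where "e = {Inl (Inl i), Inl (Inr j)}" "i < s" "j < a - s"
  | i j where "e = {Inr (Inl i), Inr (Inr j)}" "i < s" "j < b - s"
  using assms unfolding edges_two_stars by (elim UnE imageE) (auto split: prod.splits)

text \<open>The parts cross the components: leaves of the first component go together with centres
  of the second.\<close>

definition part_A :: "nat \<Rightarrow> nat \<Rightarrow> ((nat + nat) + (nat + nat)) set" where
  "part_A s a = (\<lambda>j. Inl (Inr j)) ` {..<a - s} \<union> (\<lambda>i. Inr (Inl i)) ` {..<s}"

definition part_B :: "nat \<Rightarrow> nat \<Rightarrow> ((nat + nat) + (nat + nat)) set" where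
  "part_B s b = (\<lambda>j. Inr (Inr j)) ` {..<b - s} \<union> (\<lambda>i. Inl (Inl i)) ` {..<s}"

lemma parts_two_stars:
  "part_A s a \<union> part_B s b = verts (two_stars s a b)" "part_A s a \<inter> part_B s b = {}"
  unfolding part_A_def part_B_def verts_two_stars by auto

lemma card_parts_two_stars:
  assumes "s \<le> a" "s \<le> b"
  shows "card (part_A s a) = a" "card (part_B s b) = b"
proof -
  have "card (part_A s a) = card ((\<lambda>j. Inl (Inr j) :: (nat + nat) + (nat + nat)) ` {..<a - s})
      + card ((\<lambda>i. Inr (Inl i) :: (nat + nat) + (nat + nat)) ` {..<s})"
    unfolding part_A_def by (intro card_Un_disjoint) auto
  then show "card (part_A s a) = a"
    using assms(1) by (simp add: card_image inj_on_def)
  have "card (part_B s b) = card ((\<lambda>j. Inr (Inr j) :: (nat + nat) + (nat + nat)) ` {..<b - s})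
      + card ((\<lambda>i. Inl (Inl i) :: (nat + nat) + (nat + nat)) ` {..<s})"
    unfolding part_B_def by (intro card_Un_disjoint) auto
  then show "card (part_B s b) = b"
    using assms(2) by (simp add: card_image inj_on_def)
qed

text \<open>Stated for an arbitrary edge set so that it also covers the modified graph
  \<open>linked_stars\<close>.\<close>

lemma bipartite_on_parts:
  assumes "s \<le> a" "s \<le> b"
    and edge: "\<And>e. e \<in> E \<Longrightarrow> \<exists>x\<in>part_A s a. \<exists>y\<in>part_B s b. e = {x, y}"
  shows "bipartite_graph a b (verts (two_stars s a b), E)"
proof -
  let ?G = "(verts (two_stars s a b), E)"
  have "e \<subseteq> verts ?G \<and> card e = 2" if e: "e \<in> E" for e
  proof -
    obtain x y where xy: "x \<in> part_A s a" "y \<in> part_B s b" "e = {x, y}"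
      using edge[OF e] by blast
    then have "x \<noteq> y"
      using parts_two_stars(2)[of s a b] by blast
    then show ?thesis
      using xy parts_two_stars(1)[of s a b] by auto
  qed
  moreover have "finite (verts ?G)"
    unfolding verts_two_stars fst_conv by simp
  ultimately have "simple_graph ?G"
    by (simp add: simple_graph_def)
  moreover have "bipartition ?G (part_A s a) (part_B s b)"
    using edge parts_two_stars[of s a b] by (simp add: bipartition_def)
  ultimately show ?thesis
    using card_parts_two_stars[OF assms(1,2)] unfolding bipartite_graph_def by blast
qed

lemma edge_two_stars_parts:
  assumes "e \<in> edges (two_stars s a b)"
  shows "\<exists>x\<in>part_A s a. \<exists>y\<in>part_B s b. e = {x, y}"
  using assms
proof (cases rule: edges_two_starsE)
  case (1 i j)
  then show ?thesis
    by (intro bexI[of _ "Inl (Inr j)"] bexI[of _ "Inl (Inl i)"]) (auto simp: part_A_def part_B_def)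
next
  case (2 i j)
  then show ?thesis
    by (intro bexI[of _ "Inr (Inl i)"] bexI[of _ "Inr (Inr j)"]) (auto simp: part_A_def part_B_def)
qed

lemma bipartite_two_stars:
  "\<lbrakk>s \<le> a; s \<le> b\<rbrakk> \<Longrightarrow> bipartite_graph a b (two_stars s a b)"
  using bipartite_on_parts[of s a b "edges (two_stars s a b)", OF _ _ edge_two_stars_parts] by simp

lemma card_edges_two_stars:
  assumes "s \<le> a" "s \<le> b"
  shows "card (edges (two_stars s a b)) = s * (a + b - 2 * s)"
proof -
  let ?L = "(\<lambda>(i, j). {Inl (Inl i), Inl (Inr j)}) ` ({..<s} \<times> {..<a - s}) :: ((nat + nat) + (nat + nat)) set set"
  let ?R = "(\<lambda>(i, j). {Inr (Inl i), Inr (Inr j)}) ` ({..<s} \<times> {..<b - s}) :: ((nat + nat) + (nat + nat)) set set"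
  have "card ?L = s * (a - s)" "card ?R = s * (b - s)"
    by (subst card_image; force simp: inj_on_def doubleton_eq_iff card_cartesian_product)+
  moreover have "?L \<inter> ?R = {}"
    by (auto simp: doubleton_eq_iff)
  then have "card (?L \<union> ?R) = card ?L + card ?R"
    by (intro card_Un_disjoint) auto
  moreover have "s * (a - s) + s * (b - s) = s * (a + b - 2 * s)"
    using assms unfolding distrib_left[symmetric] by (intro arg_cong[of _ _ "(*) s"]) simp
  ultimately show ?thesis
    unfolding edges_two_stars by simp
qed

text \<open>Both constructions satisfy this simple criterion, since each of their edges contains a
  leaf.\<close>

lemma double_star_free_low_ends:
  assumes "simple_graph G" "s \<le> t" "\<And>e. e \<in> edges G \<Longrightarrow> \<exists>v\<in>e. deg G v \<le> s"
  shows "free_of (double_star s t) G"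
proof (rule double_star_freeI[OF assms(1)])
  fix u v assume "{u, v} \<in> edges G"
  from assms(3)[OF this] show "deg G u \<le> s \<or> deg G v \<le> t"
    using assms(2) by auto
qed

lemma nbrs_two_stars:
  "nbrs (two_stars s a b) (Inl (Inr j)) \<subseteq> (\<lambda>i. Inl (Inl i)) ` {..<s}"
  "nbrs (two_stars s a b) (Inr (Inr j)) \<subseteq> (\<lambda>i. Inr (Inl i)) ` {..<s}"
  unfolding nbrs_def by (auto elim!: edges_two_starsE simp: doubleton_eq_iff)

lemma card_image_lessThan_le: "X \<subseteq> f ` {..<s :: nat} \<Longrightarrow> card X \<le> s"
  using surj_card_le[of "{..<s}" X f] by simp

lemma double_star_free_two_stars:
  assumes "s \<le> a" "s \<le> b" "s \<le> t"
  shows "free_of (double_star s t) (two_stars s a b)"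
proof (rule double_star_free_low_ends)
  show "simple_graph (two_stars s a b)"
    using bipartite_two_stars[OF assms(1,2)] by (simp add: bipartite_graph_def)
  fix e assume "e \<in> edges (two_stars s a b)"
  then show "\<exists>v\<in>e. deg (two_stars s a b) v \<le> s"
    using card_image_lessThan_le[OF nbrs_two_stars(1)] card_image_lessThan_le[OF nbrs_two_stars(2)]
    by (cases rule: edges_two_starsE) blast+
qed (rule assms)

lemma not_connected_two_stars:
  assumes "0 < s"
  shows "\<not> connected_graph (two_stars s a b)"
proof
  assume "connected_graph (two_stars s a b)"
  moreover have "Inl (Inl 0) \<in> verts (two_stars s a b)" "Inr (Inl 0) \<in> verts (two_stars s a b)"
    using assms unfolding verts_two_stars by auto
  ultimately have "(Inl (Inl 0), Inr (Inl 0)) \<in> {(u, v). {u, v} \<in> edges (two_stars s a b)}\<^sup>*"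
    unfolding connected_graph_def by blast
  \<comment> \<open>No edge leaves the first component, so the constructor \<open>Inl\<close> is
    invariant along walks.\<close>
  moreover have "\<exists>y'. y = Inl y'" if "(Inl x, y) \<in> {(u, v). {u, v} \<in> edges (two_stars s a b)}\<^sup>*" for x y
    using that
    by (induction rule: rtrancl_induct) (auto elim!: edges_two_starsE simp: doubleton_eq_iff)
  ultimately show False
    by blast
qed

section \<open>Uniqueness of the extremal graph\<close>

lemma bij_betw_image_param:
  assumes "bij_betw g S X" "\<And>i. i \<in> S \<Longrightarrow> f (h i) = g i"
  shows "bij_betw f (h ` S) X"
proof (rule bij_betw_imageI)
  have "inj_on (f \<circ> h) S"
    using assms by (simp add: bij_betw_def inj_on_def)
  then show "inj_on f (h ` S)"
    by (rule inj_on_imageI)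
  show "f ` h ` S = X"
    using assms by (simp add: image_image bij_betw_def)
qed

text \<open>The letter names the part; index 1 stands for leaves and index 2 for centres.
  \<open>B2\<close> and \<open>A1\<close> span the first component, \<open>A2\<close> and
  \<open>B1\<close> the second.\<close>

lemma isomorphic_two_stars:
  assumes fin: "finite (verts G)"
    and verts: "verts G = B2 \<union> A1 \<union> (A2 \<union> B1)"
    and disjoint: "B2 \<inter> A1 = {}" "A2 \<inter> B1 = {}" "(B2 \<union> A1) \<inter> (A2 \<union> B1) = {}"
    and cards: "card B2 = s" "card A1 = a - s" "card A2 = s" "card B1 = b - s"
    and edges: "edges G = {{x, y} | x y. x \<in> A1 \<and> y \<in> B2} \<union> {{x, y} | x y. x \<in> B1 \<and> y \<in> A2}"
  shows "isomorphic (two_stars s a b) G"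
proof -
  have "\<exists>g. bij_betw g {..<card X} X" if "X \<subseteq> verts G" for X
    using ex_bij_betw_nat_finite[OF finite_subset[OF that fin]] by (simp add: lessThan_atLeast0)
  from this[of B2] this[of A1] this[of A2] this[of B1] obtain g1 g2 g3 g4
    where g: "bij_betw g1 {..<s} B2" "bij_betw g2 {..<a - s} A1"
      "bij_betw g3 {..<s} A2" "bij_betw g4 {..<b - s} B1"
    unfolding verts cards by auto
  define f where "f = case_sum (case_sum g1 g2) (case_sum g3 g4)"
  have "bij_betw f (verts (two_stars s a b)) (verts G)"
    unfolding verts_two_stars verts f_def
    by (intro bij_betw_combine disjoint bij_betw_image_param[OF g(1)] bij_betw_image_param[OF g(2)]
        bij_betw_image_param[OF g(3)] bij_betw_image_param[OF g(4)]) simp_all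
  moreover have "{{x, y} | x y. x \<in> A1 \<and> y \<in> B2} = (\<lambda>(i, j). {g1 i, g2 j}) ` ({..<s} \<times> {..<a - s})"
    unfolding bij_betw_imp_surj_on[OF g(1), symmetric] bij_betw_imp_surj_on[OF g(2), symmetric] by auto
  moreover have "{{x, y} | x y. x \<in> B1 \<and> y \<in> A2} = (\<lambda>(i, j). {g3 i, g4 j}) ` ({..<s} \<times> {..<b - s})"
    unfolding bij_betw_imp_surj_on[OF g(3), symmetric] bij_betw_imp_surj_on[OF g(4), symmetric] by auto
  then have "edges G = (\<lambda>e. f ` e) ` edges (two_stars s a b)"
    unfolding edges edges_two_stars calculation(2) by (simp add: image_Un image_image case_prod_unfold f_def)
  ultimately show ?thesis
    unfolding isomorphic_def by blast
qed

lemma (in bipartite_star_sparse) extremal_isomorphic: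
  assumes "t < 2 * s" "4 * s ^ 2 < card A" "4 * s ^ 2 < card B"
    and "card (edges G) = s * (card A + card B - 2 * s)"
  shows "isomorphic G (two_stars s (card A) (card B))"
proof -
  note struct = extremal_structure[OF assms]
  have "card (A - high) = card A - s" "card (B - high) = card B - s"
    using struct(1,2) parts(3,4) by (simp_all add: card_Diff_subset_Int Int_commute)
  then have "isomorphic (two_stars s (card A) (card B)) G"
    using finite_verts parts(1,2) struct
    by (intro isomorphic_two_stars[where ?A1.0 = "A - high" and ?B1.0 = "B - high"
          and ?A2.0 = "high \<inter> A" and ?B2.0 = "high \<inter> B"]) auto
  moreover have "s \<le> card A" "s \<le> card B"
    using struct(1,2) card_mono[OF parts(3), of "high \<inter> A"] card_mono[OF parts(4), of "high \<inter> B"] by auto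
  then have "simple_graph (two_stars s (card A) (card B))"
    using bipartite_two_stars by (simp add: bipartite_graph_def)
  ultimately show ?thesis
    using isomorphic_sym by blast
qed

subsection \<open>The connected construction\<close>

text \<open>Exchanging two leaf edges, one in each component, for an edge between their leaves connects
  the two components at the cost of one edge, without creating new vertices of degree more than
  \<open>s\<close>.\<close>

definition linked_stars :: "nat \<Rightarrow> nat \<Rightarrow> nat \<Rightarrow> ((nat + nat) + (nat + nat)) graph" where
  "linked_stars s a b = (verts (two_stars s a b),
     insert {Inl (Inr 0), Inr (Inr 0)}
       (edges (two_stars s a b) - {{Inl (Inl 0), Inl (Inr 0)}, {Inr (Inl 0), Inr (Inr 0)}}))"

text \<open>The condition \<open>i \<noteq> 0 \<or> j \<noteq> 0\<close> records the two removed
  edges, those with both indices 0.\<close>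

lemma edges_linked_starsE:
  assumes "e \<in> edges (linked_stars s a b)"
  obtains "e = {Inl (Inr 0), Inr (Inr 0)}"
  | i j where "e = {Inl (Inl i), Inl (Inr j)}" "i < s" "i \<noteq> 0 \<or> j \<noteq> 0"
  | i j where "e = {Inr (Inl i), Inr (Inr j)}" "i < s" "i \<noteq> 0 \<or> j \<noteq> 0"
proof (cases "e = {Inl (Inr 0), Inr (Inr 0)}")
  case False
  then have e: "e \<in> edges (two_stars s a b)" "e \<noteq> {Inl (Inl 0), Inl (Inr 0)}" "e \<noteq> {Inr (Inl 0), Inr (Inr 0)}"
    using assms unfolding linked_stars_def by auto
  from e(1) show ?thesis
  proof (cases rule: edges_two_starsE)
    case (1 i j)
    then show ?thesis
      using that(2)[of i j] e(2) by auto
  next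
    case (2 i j)
    then show ?thesis
      using that(3)[of i j] e(3) by auto
  qed
qed (rule that)

lemma bipartite_linked_stars:
  assumes "s < a" "s < b"
  shows "bipartite_graph a b (linked_stars s a b)"
  unfolding linked_stars_def
proof (rule bipartite_on_parts)
  fix e assume "e \<in> insert {Inl (Inr 0), Inr (Inr 0)}
    (edges (two_stars s a b) - {{Inl (Inl 0), Inl (Inr 0)}, {Inr (Inl 0), Inr (Inr 0)}})"
  then consider "e = {Inl (Inr 0), Inr (Inr 0)}" | "e \<in> edges (two_stars s a b)"
    by blast
  then show "\<exists>x\<in>part_A s a. \<exists>y\<in>part_B s b. e = {x, y}"
  proof cases
    case 1
    \<comment> \<open>Leaves of different components lie in different parts, so the linking edge
      respects the bipartition.\<close>
    have "Inl (Inr 0) \<in> part_A s a" "Inr (Inr 0) \<in> part_B s b"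
      using assms unfolding part_A_def part_B_def by auto
    then show ?thesis
      unfolding 1 by blast
  qed (rule edge_two_stars_parts)
qed (use assms in auto)

lemma card_edges_linked_stars:
  assumes "0 < s" "s < a" "s < b"
  shows "card (edges (linked_stars s a b)) = s * (a + b - 2 * s) - 1"
proof -
  let ?D = "{{Inl (Inl 0), Inl (Inr 0)}, {Inr (Inl 0), Inr (Inr 0)}} :: ((nat + nat) + (nat + nat)) set set"
  have D: "?D \<subseteq> edges (two_stars s a b)"
    unfolding edges_two_stars using assms by force
  have "card ?D = 2"
    by (simp add: doubleton_eq_iff)
  have fin: "finite (edges (two_stars s a b))"
    unfolding edges_two_stars by simp
  have "card (edges (two_stars s a b) - ?D) = s * (a + b - 2 * s) - 2"
    using card_Diff_subset[OF _ D] card_edges_two_stars[of s a b] assms \<open>card ?D = 2\<close> by simp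
  \<comment> \<open>Keeps the truncated subtraction exact: removing two edges and adding one is a
    net loss of one.\<close>
  moreover have "2 \<le> s * (a + b - 2 * s)"
    using card_mono[OF fin D] card_edges_two_stars[of s a b] assms \<open>card ?D = 2\<close> by simp
  moreover have "{Inl (Inr 0), Inr (Inr 0)} \<notin> edges (two_stars s a b)"
    unfolding edges_two_stars by (auto simp: doubleton_eq_iff)
  then have "card (edges (linked_stars s a b)) = Suc (card (edges (two_stars s a b) - ?D))"
    unfolding linked_stars_def using fin by simp
  ultimately show ?thesis
    by linarith
qed

text \<open>Leaf 0 trades centre 0 for the other leaf 0, so the indices below \<open>s\<close> still
  enumerate all neighbours; the conditional encodes this trade.\<close>

lemma nbrs_linked_stars:
  assumes "0 < s"
  shows "nbrs (linked_stars s a b) (Inl (Inr j)) \<subseteq> (\<lambda>i. if i = 0 \<and> j = 0 then Inr (Inr 0) else Inl (Inl i)) ` {..<s}"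
    "nbrs (linked_stars s a b) (Inr (Inr j)) \<subseteq> (\<lambda>i. if i = 0 \<and> j = 0 then Inl (Inr 0) else Inr (Inl i)) ` {..<s}"
proof -
  show "nbrs (linked_stars s a b) (Inl (Inr j)) \<subseteq> (\<lambda>i. if i = 0 \<and> j = 0 then Inr (Inr 0) else Inl (Inl i)) ` {..<s}"
  proof
    fix u assume "u \<in> nbrs (linked_stars s a b) (Inl (Inr j))"
    then have "{Inl (Inr j), u} \<in> edges (linked_stars s a b)"
      by (simp add: nbrs_def)
    then show "u \<in> (\<lambda>i. if i = 0 \<and> j = 0 then Inr (Inr 0) else Inl (Inl i)) ` {..<s}"
    proof (cases rule: edges_linked_starsE)
      case 1
      then show ?thesis
        using assms by (intro image_eqI[of _ _ 0]) (auto simp: doubleton_eq_iff)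
    next
      case (2 i k)
      then show ?thesis
        by (intro image_eqI[of _ _ i]) (auto simp: doubleton_eq_iff)
    qed (simp add: doubleton_eq_iff)
  qed
  show "nbrs (linked_stars s a b) (Inr (Inr j)) \<subseteq> (\<lambda>i. if i = 0 \<and> j = 0 then Inl (Inr 0) else Inr (Inl i)) ` {..<s}"
  proof
    fix u assume "u \<in> nbrs (linked_stars s a b) (Inr (Inr j))"
    then have "{Inr (Inr j), u} \<in> edges (linked_stars s a b)"
      by (simp add: nbrs_def)
    then show "u \<in> (\<lambda>i. if i = 0 \<and> j = 0 then Inl (Inr 0) else Inr (Inl i)) ` {..<s}"
    proof (cases rule: edges_linked_starsE)
      case 1
      then show ?thesis
        using assms by (intro image_eqI[of _ _ 0]) (auto simp: doubleton_eq_iff)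
    next
      case (3 i k)
      then show ?thesis
        by (intro image_eqI[of _ _ i]) (auto simp: doubleton_eq_iff)
    qed (simp add: doubleton_eq_iff)
  qed
qed

lemma double_star_free_linked_stars:
  assumes "0 < s" "s < a" "s < b" "s \<le> t"
  shows "free_of (double_star s t) (linked_stars s a b)"
proof (rule double_star_free_low_ends)
  show "simple_graph (linked_stars s a b)"
    using bipartite_linked_stars[OF assms(2,3)] by (simp add: bipartite_graph_def)
  have low: "deg (linked_stars s a b) (Inl (Inr j)) \<le> s" "deg (linked_stars s a b) (Inr (Inr j)) \<le> s" for j
    using card_image_lessThan_le[OF nbrs_linked_stars(1)[OF assms(1)]]
      card_image_lessThan_le[OF nbrs_linked_stars(2)[OF assms(1)]] by blast+
  fix e assume "e \<in> edges (linked_stars s a b)"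
  then show "\<exists>v\<in>e. deg (linked_stars s a b) v \<le> s"
    by (cases rule: edges_linked_starsE) (use low in blast)+
qed (rule assms)

lemma edges_linked_starsI:
  "\<lbrakk>i < s; j < a - s; i \<noteq> 0 \<or> j \<noteq> 0\<rbrakk> \<Longrightarrow> {Inl (Inl i), Inl (Inr j)} \<in> edges (linked_stars s a b)"
  "\<lbrakk>i < s; j < b - s; i \<noteq> 0 \<or> j \<noteq> 0\<rbrakk> \<Longrightarrow> {Inr (Inl i), Inr (Inr j)} \<in> edges (linked_stars s a b)"
  "{Inl (Inr 0), Inr (Inr 0)} \<in> edges (linked_stars s a b)"
proof -
  have "{Inl (Inl i), Inl (Inr j)} \<in> edges (two_stars s a b)" if "i < s" "j < a - s"
    unfolding edges_two_stars using that by (intro UnI1 image_eqI[of _ _ "(i, j)"]) simp_all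
  moreover have "{Inr (Inl i), Inr (Inr j)} \<in> edges (two_stars s a b)" if "i < s" "j < b - s"
    unfolding edges_two_stars using that by (intro UnI2 image_eqI[of _ _ "(i, j)"]) simp_all
  ultimately show "\<lbrakk>i < s; j < a - s; i \<noteq> 0 \<or> j \<noteq> 0\<rbrakk> \<Longrightarrow> {Inl (Inl i), Inl (Inr j)} \<in> edges (linked_stars s a b)"
    "\<lbrakk>i < s; j < b - s; i \<noteq> 0 \<or> j \<noteq> 0\<rbrakk> \<Longrightarrow> {Inr (Inl i), Inr (Inr j)} \<in> edges (linked_stars s a b)"
    by (simp_all add: linked_stars_def doubleton_eq_iff)
qed (simp add: linked_stars_def)

text \<open>Leaf 0 stays attached to centre 1, which reaches all leaves, and centre 0 is recovered
  through leaf 1. For \<open>s = 1\<close> the linking edge would be a component of its own.\<close>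

lemma connected_linked_stars:
  assumes "2 \<le> s" "s + 2 \<le> a" "s + 2 \<le> b"
  shows "connected_graph (linked_stars s a b)"
proof -
  let ?R = "{(u, v). {u, v} \<in> edges (linked_stars s a b)}"
  have "sym ?R"
    unfolding sym_def by (simp add: insert_commute)
  then have sym: "(x, y) \<in> ?R\<^sup>* \<Longrightarrow> (y, x) \<in> ?R\<^sup>*" for x y
    by (meson symD sym_rtrancl)
  have step: "\<lbrakk>(x, y) \<in> ?R\<^sup>*; {y, z} \<in> edges (linked_stars s a b)\<rbrakk> \<Longrightarrow> (x, z) \<in> ?R\<^sup>*" for x y z
    by (rule rtrancl_into_rtrancl) auto
  note edge = edges_linked_starsI[where s = s and a = a and b = b]
  let ?root = "Inl (Inr 0)"
  have link: "(?root, Inr (Inr 0)) \<in> ?R\<^sup>*"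
    using edge(3) by (rule step[OF rtrancl_refl])
  have l1: "(?root, Inl (Inl i)) \<in> ?R\<^sup>*" if "i < s" "i \<noteq> 0" for i
    using step[OF rtrancl_refl, of ?root] edge(1)[of i 0] that assms by (simp add: insert_commute)
  have l2: "(?root, Inl (Inr j)) \<in> ?R\<^sup>*" if "j < a - s" for j
    using step[OF l1[of 1], of "Inl (Inr j)"] edge(1)[of 1 j] that assms by simp
  have l3: "(?root, Inl (Inl 0)) \<in> ?R\<^sup>*"
    using step[OF l2[of 1], of "Inl (Inl 0)"] edge(1)[of 0 1] assms by (simp add: insert_commute)
  have r1: "(?root, Inr (Inl i)) \<in> ?R\<^sup>*" if "i < s" "i \<noteq> 0" for i
    using step[OF link, of "Inr (Inl i)"] edge(2)[of i 0] that assms by (simp add: insert_commute)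
  have r2: "(?root, Inr (Inr j)) \<in> ?R\<^sup>*" if "j < b - s" for j
    using step[OF r1[of 1], of "Inr (Inr j)"] edge(2)[of 1 j] that assms by simp
  have r3: "(?root, Inr (Inl 0)) \<in> ?R\<^sup>*"
    using step[OF r2[of 1], of "Inr (Inl 0)"] edge(2)[of 0 1] assms by (simp add: insert_commute)
  have reach: "(?root, x) \<in> ?R\<^sup>*" if "x \<in> verts (linked_stars s a b)" for x
  proof -
    have "x \<in> verts (two_stars s a b)"
      using that by (simp add: linked_stars_def)
    then consider i where "x = Inl (Inl i)" "i < s" | j where "x = Inl (Inr j)" "j < a - s"
      | i where "x = Inr (Inl i)" "i < s" | j where "x = Inr (Inr j)" "j < b - s"
      unfolding verts_two_stars by blast
    then show ?thesis
    proof cases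
      case (1 i)
      then show ?thesis using l1[of i] l3 by (cases "i = 0") simp_all
    next
      case (2 j)
      then show ?thesis using l2[of j] by simp
    next
      case (3 i)
      then show ?thesis using r1[of i] r3 by (cases "i = 0") simp_all
    next
      case (4 j)
      then show ?thesis using r2[of j] by simp
    qed
  qed
  have "?root \<in> verts (linked_stars s a b)"
    using assms unfolding linked_stars_def verts_two_stars by auto
  then show ?thesis
    unfolding connected_graph_def using rtrancl_trans[OF sym[OF reach] reach] by blast
qed

text \<open>Turns the exclusion of P_4 into \<open>s \<noteq> 1\<close>. The map \<open>f\<close>
  reads the double star as the path (0,1), (0,0), (1,0), (1,1).\<close>

lemma double_star_1_1_isomorphic_path: "isomorphic (double_star 1 1) (path_graph 4)"
proof -
  define f :: "nat \<times> nat \<Rightarrow> nat" where "f = (\<lambda>(i, j). if i = 0 then 1 - j else 2 + j)"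
  have verts: "verts (double_star 1 1) = {(0, 0), (0, 1), (1, 0), (1, 1)}"
    "verts (path_graph 4) = {0, 1, 2, 3}"
    by (auto simp: double_star_def path_graph_def)
  have edges: "edges (double_star 1 1) = {{(0, 0), (1, 0)}, {(0, 0), (0, 1)}, {(1, 0), (1, 1)}}"
    by (simp add: double_star_def insert_commute)
  have "Suc i < 4 \<longleftrightarrow> i \<in> {0, 1, 2}" for i
    by auto
  then have "{{i, Suc i} | i. Suc i < 4} = (\<lambda>i. {i, Suc i}) ` {0, 1, 2}"
    by (simp only:) blast
  then have "edges (path_graph 4) = {{0, 1}, {1, 2}, {2, 3}}"
    by (simp add: path_graph_def numeral_2_eq_2 numeral_3_eq_3)
  also have "\<dots> = (\<lambda>e. f ` e) ` edges (double_star 1 1)"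
    unfolding edges by (auto simp: f_def insert_commute)
  finally have "edges (path_graph 4) = (\<lambda>e. f ` e) ` edges (double_star 1 1)" .
  moreover have "bij_betw f (verts (double_star 1 1)) (verts (path_graph 4))"
    unfolding verts by (rule bij_betw_imageI) (auto simp: f_def)
  ultimately show ?thesis
    unfolding isomorphic_def by blast
qed

subsection \<open>Extremal numbers\<close>

lemma double_star_free_sparse:
  assumes "bipartite_graph a b G" "free_of (double_star s t) G" "s \<le> t"
  obtains A B where "bipartite_star_sparse G s t A B" "card A = a" "card B = b"
proof -
  obtain A B where AB: "simple_graph G" "bipartition G A B" "card A = a" "card B = b"
    using assms(1) by (auto simp: bipartite_graph_def)
  have "bipartite_star_sparse G s t A B"
    using AB(1,2) assms(3) double_star_freeD[OF AB(1) bipartite_two_coloured[OF AB(2)] assms(2)]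
    by unfold_locales auto
  then show ?thesis
    using that AB(3,4) by blast
qed

text \<open>The two consequences of the cubic bound that enter the proof: the first feeds the
  discharging, the second the constructions.\<close>

lemma large_part_bounds: "4 * (s + 1) ^ 3 \<le> n \<Longrightarrow> 4 * s ^ 2 < (n :: nat)" "4 * (s + 1) ^ 3 \<le> n \<Longrightarrow> s + 2 \<le> (n :: nat)"
proof -
  assume n: "4 * (s + 1) ^ 3 \<le> n"
  have "s ^ 2 < (s + 1) ^ 3" "s + 1 \<le> (s + 1) ^ 3"
    by (simp_all add: power2_eq_square power3_eq_cube)
  with n show "4 * s ^ 2 < n" "s + 2 \<le> n"
    by linarith+
qed

lemma double_star_small:
  assumes st: "s \<le> t" "t < 2 * s" and large: "4 * (s + 1) ^ 3 \<le> a" "4 * (s + 1) ^ 3 \<le> b"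
    and G: "bipartite_graph a b G" "free_of (double_star s t) G"
  shows "card (edges G) \<le> s * (a + b - 2 * s)"
    and "card (edges G) = s * (a + b - 2 * s) \<Longrightarrow> isomorphic G (two_stars s a b)"
proof -
  obtain A B where AB: "bipartite_star_sparse G s t A B" "card A = a" "card B = b"
    using double_star_free_sparse[OF G st(1)] .
  note sq = large_part_bounds(1)[OF large(1)] large_part_bounds(1)[OF large(2)]
  show "card (edges G) \<le> s * (a + b - 2 * s)"
    using bipartite_star_sparse.card_edges_le_small[OF AB(1) st(2)] AB(2,3) sq by simp
  show "isomorphic G (two_stars s a b)" if "card (edges G) = s * (a + b - 2 * s)"
    using bipartite_star_sparse.extremal_isomorphic[OF AB(1) st(2)] AB(2,3) sq that by simp
qed

lemma ex_b_double_star_small: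
  assumes st: "s \<le> t" "t < 2 * s" and large: "4 * (s + 1) ^ 3 \<le> a" "4 * (s + 1) ^ 3 \<le> b"
  shows "ex_b a b (double_star s t) = s * (a + b - 2 * s)"
proof (rule antisym)
  show "ex_b a b (double_star s t) \<le> s * (a + b - 2 * s)"
    by (rule ex_b_leI[OF simple_double_star edges_double_star_nonempty double_star_small(1)[OF assms]])
  have s: "s \<le> a" "s \<le> b"
    using large_part_bounds(2)[OF large(1)] large_part_bounds(2)[OF large(2)] by simp_all
  show "s * (a + b - 2 * s) \<le> ex_b a b (double_star s t)"
    using card_edges_le_ex_b[OF simple_double_star bipartite_two_stars[OF s] double_star_free_two_stars[OF s st(1)]]
      card_edges_two_stars[OF s] by simp
qed

text \<open>A connected graph attaining the unrestricted maximum would be isomorphic to the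
  disconnected \<open>two_stars\<close>, so at least one edge is lost; \<open>linked_stars\<close>
  loses exactly one.\<close>

lemma ex_bc_double_star_small:
  assumes st: "s \<le> t" "t < 2 * s" "2 \<le> s" and large: "4 * (s + 1) ^ 3 \<le> a" "4 * (s + 1) ^ 3 \<le> b"
  shows "ex_bc a b (double_star s t) = s * (a + b - 2 * s) - 1"
proof (rule antisym)
  have ab: "0 < s" "s < a" "s < b" "s + 2 \<le> a" "s + 2 \<le> b"
    using st(3) large_part_bounds(2)[OF large(1)] large_part_bounds(2)[OF large(2)] by simp_all
  note linked = bipartite_linked_stars[OF ab(2,3)] connected_linked_stars[OF st(3) ab(4,5)]
    double_star_free_linked_stars[OF ab(1-3) st(1)]
  show "s * (a + b - 2 * s) - 1 \<le> ex_bc a b (double_star s t)"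
    using card_edges_le_ex_bc[OF simple_double_star linked] card_edges_linked_stars[OF ab(1-3)] by simp
  show "ex_bc a b (double_star s t) \<le> s * (a + b - 2 * s) - 1"
  proof (rule ex_bc_leI[OF simple_double_star linked])
    fix G :: "nat graph"
    assume G: "bipartite_graph a b G" "connected_graph G" "free_of (double_star s t) G"
    have "card (edges G) \<noteq> s * (a + b - 2 * s)"
      using double_star_small(2)[OF st(1,2) large G(1,3)] isomorphic_connected_graph[OF _ G(2)]
        not_connected_two_stars[OF ab(1)] by blast
    then show "card (edges G) \<le> s * (a + b - 2 * s) - 1"
      using double_star_small(1)[OF st(1,2) large G(1,3)] by linarith
  qed
qed

text \<open>Doubled to avoid halving on \<open>nat\<close>. The lower bound comes from copies of
  K_{t,t}, with t a = t (a + a) / 2 edges.\<close>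

lemma ex_b_double_star_large:
  assumes "2 * s \<le> t" "1 \<le> t"
  shows "2 * ex_b a b (double_star s t) \<le> t * (a + b)"
    and "t dvd a \<Longrightarrow> t * a \<le> ex_b a a (double_star s t)"
proof -
  have "ex_b a b (double_star s t) \<le> t * (a + b) div 2"
  proof (rule ex_b_leI[OF simple_double_star edges_double_star_nonempty])
    fix G :: "nat graph"
    assume G: "bipartite_graph a b G" "free_of (double_star s t) G"
    obtain A B where AB: "bipartite_star_sparse G s t A B" "card A = a" "card B = b"
      using double_star_free_sparse[OF G] assms(1) by auto
    interpret bipartite_star_sparse G s t A B
      by (rule AB(1))
    show "card (edges G) \<le> t * (a + b) div 2"
      using card_edges_le[OF assms(1)] parts(5) AB(2,3) by simp
  qed
  then show "2 * ex_b a b (double_star s t) \<le> t * (a + b)"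
    by simp
  show "t * a \<le> ex_b a a (double_star s t)" if "t dvd a"
    using card_edges_le_ex_b[OF simple_double_star bipartite_blocks double_star_free_blocks, of t a s]
      card_edges_blocks[OF that] assms(2) by simp
qed

text \<open>Copies of K_{2l,2l} have 2 l a = l (a + a) edges.\<close>

lemma ex_b_S_tree:
  shows "ex_b a b (S_tree l) \<le> l * (a + b)"
    and "\<lbrakk>0 < l; 2 * l dvd a\<rbrakk> \<Longrightarrow> l * (a + a) \<le> ex_b a a (S_tree l)"
proof -
  show "ex_b a b (S_tree l) \<le> l * (a + b)"
  proof (rule ex_b_leI[OF simple_S_tree edges_S_tree_nonempty])
    fix G :: "nat graph"
    assume G: "bipartite_graph a b G" "free_of (S_tree l) G"
    obtain A B where AB: "simple_graph G" "bipartition G A B" "card A = a" "card B = b"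
      using G(1) by (auto simp: bipartite_graph_def)
    then show "card (edges G) \<le> l * (a + b)"
      using S_tree_free_card_edges_le[OF AB(1) bipartite_two_coloured[OF AB(2)] G(2)]
        bipartition_finite(3)[OF AB(1,2)] by simp
  qed
  show "l * (a + a) \<le> ex_b a a (S_tree l)" if "0 < l" "2 * l dvd a"
    using card_edges_le_ex_b[OF simple_S_tree bipartite_blocks S_tree_free_blocks[OF that(1)], of a]
      card_edges_blocks[OF that(2)] by (simp add: algebra_simps)
qed

lemma ex_b_P_tree:
  assumes "s < max r t"
  shows "ex_b a b (P_tree r s t) \<le> max r t * (a + b)"
proof (rule ex_b_leI[OF simple_P_tree edges_P_tree_nonempty])
  fix G :: "nat graph"
  assume G: "bipartite_graph a b G" "free_of (P_tree r s t) G"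
  obtain A B where AB: "simple_graph G" "bipartition G A B" "card A = a" "card B = b"
    using G(1) by (auto simp: bipartite_graph_def)
  then show "card (edges G) \<le> max r t * (a + b)"
    using P_tree_free_card_edges_le[OF AB(1) bipartite_two_coloured[OF AB(2)] G(2) _ _ assms]
      bipartition_finite(3)[OF AB(1,2)] by simp
qed

theorem theorem9:
  fixes a b :: nat
  assumes "1 \<le> a" and "a \<le> b"
  shows
    "(\<forall>s t p q :: nat.
        bipartite_graph p q (double_star s t) \<and> p \<le> q \<and> p \<le> a \<and> q \<le> b \<and>
        1 \<le> s \<and> 1 \<le> t \<and> s \<le> t \<and> t < 2 * s \<and> 4 * (s + 1) ^ 3 \<le> a \<and> 4 * (s + 1) ^ 3 \<le> b \<longrightarrow>
        ex_b a b (double_star s t) = s * (a + b - 2 * s) \<and>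
        extremal_b a b (double_star s t)
          (disjoint_union (complete_bipartite s (a - s)) (complete_bipartite s (b - s))) \<and>
        (\<forall>G :: 'v graph. extremal_b a b (double_star s t) G \<longrightarrow>
          isomorphic G
            (disjoint_union (complete_bipartite s (a - s)) (complete_bipartite s (b - s))))) \<and>
     (\<forall>s t p q :: nat.
        bipartite_graph p q (double_star s t) \<and> p \<le> q \<and> p \<le> a \<and> q \<le> b \<and>
        1 \<le> s \<and> 1 \<le> t \<and> s \<le> t \<and> t < 2 * s \<and>
        \<not> isomorphic (double_star s t) (path_graph 4) \<and>
        4 * (s + 1) ^ 3 \<le> a \<and> 4 * (s + 1) ^ 3 \<le> b \<longrightarrow>
        ex_bc a b (double_star s t) = s * (a + b - 2 * s) - 1) \<and>
     (\<forall>s t p q :: nat.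
        bipartite_graph p q (double_star s t) \<and> p \<le> q \<and> p \<le> a \<and> q \<le> b \<and>
        1 \<le> s \<and> 1 \<le> t \<and> 2 * s \<le> t \<longrightarrow>
        real (ex_b a b (double_star s t)) \<le> real t * (real a + real b) / 2 \<and>
        (a = b \<and> t dvd a \<longrightarrow>
          real (ex_b a b (double_star s t)) = real t * (real a + real b) / 2)) \<and>
     (\<forall>l p q :: nat.
        bipartite_graph p q (S_tree l) \<and> p \<le> q \<and> p \<le> a \<and> q \<le> b \<and> 2 \<le> l \<longrightarrow>
        ex_b a b (S_tree l) \<le> l * (a + b) \<and>
        (a = b \<and> 2 * l dvd a \<longrightarrow> ex_b a b (S_tree l) = l * (a + b))) \<and>
     (\<forall>r s t p q :: nat.
        bipartite_graph p q (P_tree r s t) \<and> p \<le> q \<and> p \<le> a \<and> q \<le> b \<and>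
        1 \<le> r \<and> 1 \<le> t \<and> s < max r t \<longrightarrow>
        ex_b a b (P_tree r s t) \<le> max r t * (a + b))"
proof (intro conjI allI impI; elim conjE)
  fix s t :: nat
  assume st: "s \<le> t" "t < 2 * s" and large: "4 * (s + 1) ^ 3 \<le> a" "4 * (s + 1) ^ 3 \<le> b"
  have s: "s \<le> a" "s \<le> b"
    using large_part_bounds(2)[OF large(1)] large_part_bounds(2)[OF large(2)] by simp_all
  show ex: "ex_b a b (double_star s t) = s * (a + b - 2 * s)"
    by (rule ex_b_double_star_small[OF st large])
  show "extremal_b a b (double_star s t) (two_stars s a b)"
    unfolding extremal_b_def ex
    using bipartite_two_stars[OF s] double_star_free_two_stars[OF s st(1)] card_edges_two_stars[OF s] by blast
  show "isomorphic G (two_stars s a b)" if "extremal_b a b (double_star s t) G" for G :: "'v graph"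
    using that double_star_small(2)[OF st large] unfolding extremal_b_def ex by blast
next
  fix s t :: nat
  assume st: "1 \<le> s" "s \<le> t" "t < 2 * s" "\<not> isomorphic (double_star s t) (path_graph 4)"
    and large: "4 * (s + 1) ^ 3 \<le> a" "4 * (s + 1) ^ 3 \<le> b"
  \<comment> \<open>For \<open>s = 1\<close> the bound \<open>t < 2 * s\<close> forces
    \<open>t = 1\<close>, and D_{1,1} is P_4.\<close>
  have "s \<noteq> 1"
  proof
    assume "s = 1"
    moreover from this have "t = 1"
      using st by simp
    ultimately show False
      using st(4) double_star_1_1_isomorphic_path by simp
  qed
  then have "2 \<le> s"
    using st(1) by simp
  then show "ex_bc a b (double_star s t) = s * (a + b - 2 * s) - 1"
    by (rule ex_bc_double_star_small[OF st(2,3) _ large])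
next
  fix s t :: nat
  assume t: "1 \<le> t" "2 * s \<le> t"
  have "real (2 * ex_b a b (double_star s t)) \<le> real (t * (a + b))"
    unfolding of_nat_le_iff by (rule ex_b_double_star_large(1)[OF t(2,1)])
  then show le: "real (ex_b a b (double_star s t)) \<le> real t * (real a + real b) / 2"
    by simp
  assume "a = b" "t dvd a"
  then have "real (t * a) \<le> real (ex_b a b (double_star s t))"
    unfolding of_nat_le_iff using ex_b_double_star_large(2)[OF t(2,1), of a] by simp
  then show "real (ex_b a b (double_star s t)) = real t * (real a + real b) / 2"
    using le \<open>a = b\<close> by simp
next
  fix l :: nat
  assume "2 \<le> l"
  show le: "ex_b a b (S_tree l) \<le> l * (a + b)"
    by (rule ex_b_S_tree(1))
  assume "a = b" "2 * l dvd a"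
  then show "ex_b a b (S_tree l) = l * (a + b)"
    using le ex_b_S_tree(2)[of l a] \<open>2 \<le> l\<close> by simp
next
  fix r s t :: nat
  assume "s < max r t"
  then show "ex_b a b (P_tree r s t) \<le> max r t * (a + b)"
    by (rule ex_b_P_tree)
qed

end
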